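(* Let $G$ be a topological group that is not locally compact, let $bG$ be a Hausdorff compactification of $G$, and let $Y = bG \setminus G$. If $Y$ has locally a quasi-$G_\delta$-diagonal, then $G$ and $bG$ are separable and metrizable.
   Context: All spaces (including topological groups) are assumed Hausdorff. A Hausdorff compactification $bG$ of $G$ is a compact Hausdorff space containing $G$ as a dense subspace. A space $X$ has locally a property $\Phi$ if for each $x \in X$ there is an open set $U$ with $x \in U$ such that the subspace $U$ has property $\Phi$. For a family $\mathcal{G}$ of subsets of $X$ and $x\in X$, $\mathrm{st}(x,\mathcal{G}) = \bigcup\{G \in \mathcal{G} : x \in G\}$. A space $X$ has a quasi-$G_\delta$-diagonal if there is a sequence $\{\mathcal{G}_n\}_{n \in \mathbb{N}}$ of families of open subsets of $X$ such that for each $x \in X$ the collection $\{\mathrm{st}(x,\mathcal{G}_n) : n \in \mathbb{N},\ \mathrm{st}(x,\mathcal{G}_n) \ne \emptyset\}$ is a $p$-network at $x$, i.e. for every $y \in X$ with $y \neq x$ there is $n$ with $x \in \mathrm{st}(x,\mathcal{G}_n) \subset X \setminus \{y\}$. *)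

theory Defs
  imports "HOL-Algebra.Group" "HOL-Analysis.Analysis"
begin

no_notation eq_closure_of (\<open>closure'_of\<index>\<close>)

text \<open>Hausdorff spaces throughout; in particular a topological group is Hausdorff by convention.\<close>

locale topological_group = group G for G (structure) +
  fixes T :: "'a topology"
  assumes topspace_eq: "topspace T = carrier G"
    and Hausdorff: "Hausdorff_space T"
    and continuous_mult: "continuous_map (prod_topology T T) T (\<lambda>(x, y). x \<otimes> y)"
    and continuous_inv: "continuous_map T T (\<lambda>x. inv x)"

text \<open>The space is a genuine subspace of its compactification, rather than embedded in it, so that
  the remainder is a set difference.\<close>

definition Hausdorff_compactification :: "'a topology \<Rightarrow> 'a topology \<Rightarrow> bool" where
  "Hausdorff_compactification X bX \<longleftrightarrow>
     compact_space bX \<and> Hausdorff_space bX \<and>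
     topspace X \<subseteq> topspace bX \<and> subtopology bX (topspace X) = X \<and>
     bX closure_of topspace X = topspace bX"

definition remainder :: "'a topology \<Rightarrow> 'a topology \<Rightarrow> 'a topology" where
  "remainder X bX = subtopology bX (topspace bX - topspace X)"

definition has_locally :: "('a topology \<Rightarrow> bool) \<Rightarrow> 'a topology \<Rightarrow> bool" where
  "has_locally \<Phi> X \<longleftrightarrow> (\<forall>x\<in>topspace X. \<exists>U. openin X U \<and> x \<in> U \<and> \<Phi> (subtopology X U))"

definition star :: "'a \<Rightarrow> 'a set set \<Rightarrow> 'a set" where
  "star x \<G> = \<Union>{U \<in> \<G>. x \<in> U}"

definition p_network_at :: "'a topology \<Rightarrow> 'a \<Rightarrow> 'a set set \<Rightarrow> bool" where
  "p_network_at X x \<P> \<longleftrightarrow>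
     (\<forall>y\<in>topspace X. y \<noteq> x \<longrightarrow> (\<exists>P\<in>\<P>. x \<in> P \<and> P \<subseteq> topspace X - {y}))"

text \<open>The families need not cover the space, so \<open>star x (\<G> n)\<close> may be empty.\<close>

definition quasi_Gdelta_diagonal :: "'a topology \<Rightarrow> bool" where
  "quasi_Gdelta_diagonal X \<longleftrightarrow>
     (\<exists>\<G> :: nat \<Rightarrow> 'a set set.
        (\<forall>n. \<forall>U\<in>\<G> n. openin X U) \<and>
        (\<forall>x\<in>topspace X. p_network_at X x {star x (\<G> n) | n. star x (\<G> n) \<noteq> {}}))"

end

theory Submission
  imports Defs
begin

text \<open>
  Write \<open>B\<close> for the compactification, \<open>X\<close> for the group inside it and \<open>Y = B - X\<close> for the
  remainder. A topological group with a nonempty open set inside a compact set is locally compact, so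
  here \<open>Y\<close> is dense in \<open>B\<close> just as \<open>X\<close> is, and information can be carried from one to the other along
  open sets of \<open>B\<close>. It suffices to find a countable network of \<open>B\<close>: countably many Urysohn functions
  then separate the points, and every subspace is separable
  (\<open>compact_Hausdorff_network_metrizable\<close>, \<open>network_on_separable\<close>).

  Two facts about a quasi-\<open>G\<^sub>\<delta>\<close>-diagonal carry the proof. A countably compact set with such a diagonal is
  compact (\<open>countably_compact_separating_imp_compact\<close>, after Chaber). A set that is cut out of \<open>B\<close> by
  countably many closed sets in the manner of a Lindelof \<open>\<Sigma>\<close>-space and has such a diagonal has a
  countable network (\<open>separating_families_network\<close>); in particular this holds for compact sets.

  The first fact yields a compact set \<open>F \<subseteq> X\<close> and a sequence of nonempty open sets such that every
  neighbourhood of \<open>F\<close> contains one of them (\<open>countable_pi_base_at_compact\<close>). Suppose there were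
  none. Then \<open>Y\<close> behaves like a pseudocompact space, so its points, being \<open>G\<^sub>\<delta>\<close> in \<open>Y\<close>, have
  countable bases in \<open>B\<close>; the bases at the points of a sequence in \<open>Y\<close> would form a countable
  \<open>\<pi>\<close>-base at any cluster point in \<open>X\<close>, so all cluster points lie in \<open>Y\<close>, and \<open>Y\<close> is locally
  countably compact. But then it is locally compact, hence open, against the density of \<open>X\<close>.

  The differences \<open>a\<inverse>b\<close> turn \<open>F\<close> into a compact set \<open>H\<close> with a countable neighbourhood base made of
  neighbourhoods \<open>W\<^sub>n\<close> of the unit (\<open>compact_countable_character\<close>). Moreover, countably many
  translates of any neighbourhood of the unit cover the group, because an uncountable uniformly discrete
  family of translates would accumulate at a compact subset of \<open>Y\<close>, which is a \<open>G\<^sub>\<delta>\<close> in \<open>Y\<close>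
  (\<open>narrow_covering\<close>). Hence countably many translates of the \<open>W\<^sub>n\<close> separate every point of \<open>X\<close> from
  every point of \<open>Y\<close>. Their complements cut out \<open>Y\<close>, so the second fact gives \<open>Y\<close> a countable
  network, and it follows that \<open>B\<close> has a countable \<open>\<pi>\<close>-base. Its traces form a countable \<open>\<pi>\<close>-base of the
  group, and by homogeneity this gives the group a countable network too
  (\<open>countable_pi_base_imp_network\<close>).
\<close>

section \<open>Separating families and networks\<close>

text \<open>
  A quasi-\<open>G\<^sub>\<delta>\<close>-diagonal of the subspace \<open>S\<close>, given by open sets of the ambient space. In this form
  it is inherited by subsets of \<open>S\<close>, and no subspace topology has to be mentioned.
\<close>

definition separating_families :: "'a topology \<Rightarrow> 'a set \<Rightarrow> (nat \<Rightarrow> 'a set set) \<Rightarrow> bool" where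
  "separating_families X S \<G> \<longleftrightarrow>
     (\<forall>n. \<forall>U\<in>\<G> n. openin X U) \<and>
     (\<forall>x\<in>S. \<forall>y\<in>S. x \<noteq> y \<longrightarrow> (\<exists>n. x \<in> \<Union>(\<G> n) \<and> (\<forall>U\<in>\<G> n. x \<in> U \<longrightarrow> y \<notin> U)))"

definition network_on :: "'a topology \<Rightarrow> 'a set \<Rightarrow> 'a set set \<Rightarrow> bool" where
  "network_on X S \<N> \<longleftrightarrow>
     (\<forall>x\<in>S. \<forall>U. openin X U \<and> x \<in> U \<longrightarrow> (\<exists>A\<in>\<N>. x \<in> A \<and> A \<inter> S \<subseteq> U))"

section \<open>Compactness and countable closures\<close>

lemma countable_binary_closure:
  fixes g :: "'b \<Rightarrow> 'b \<Rightarrow> 'b set"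
  assumes A: "countable A" and g: "\<And>x y. countable (g x y)"
  obtains L where "countable L" "A \<subseteq> L" "\<And>x y. x \<in> L \<Longrightarrow> y \<in> L \<Longrightarrow> g x y \<subseteq> L"
proof -
  define step where "step M = M \<union> (\<Union>x\<in>M. \<Union>y\<in>M. g x y)" for M
  define M where "M k = (step ^^ k) A" for k
  have M_Suc: "M (Suc k) = step (M k)" for k
    by (simp add: M_def)
  have "countable (M k)" for k
  proof (induction k)
    case 0
    then show ?case by (simp add: M_def A)
  next
    case (Suc k)
    then show ?case unfolding M_Suc step_def using g by auto
  qed
  then have "countable (\<Union>k. M k)"
    by blast
  moreover have "A \<subseteq> (\<Union>k. M k)"
  proof -
    have "M 0 = A" by (simp add: M_def)
    then show ?thesis by blast
  qed
  moreover have "g x y \<subseteq> (\<Union>k. M k)" if "x \<in> (\<Union>k. M k)" "y \<in> (\<Union>k. M k)" for x y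
  proof -
    have "M k \<subseteq> M (Suc k)" for k
      unfolding M_Suc step_def by blast
    then have mono: "M i \<subseteq> M j" if "i \<le> j" for i j
      using lift_Suc_mono_le that by metis
    obtain i j where "x \<in> M i" "y \<in> M j"
      using \<open>x \<in> (\<Union>k. M k)\<close> \<open>y \<in> (\<Union>k. M k)\<close> by blast
    then have "x \<in> M (max i j)" "y \<in> M (max i j)"
      using mono max.cobounded1 max.cobounded2 by blast+
    then have "g x y \<subseteq> M (Suc (max i j))"
      unfolding M_Suc step_def by blast
    then show ?thesis by blast
  qed
  ultimately show ?thesis
    by (rule that)
qed

lemma Inter_mem_of_Int_closed:
  assumes "finite \<H>" "\<H> \<noteq> {}" "\<H> \<subseteq> \<F>" "\<And>F F'. F \<in> \<F> \<Longrightarrow> F' \<in> \<F> \<Longrightarrow> F \<inter> F' \<in> \<F>"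
  shows "\<Inter>\<H> \<in> \<F>"
  using assms by (induction rule: finite_ne_induct) auto

text \<open>
  The form in which compactness is used below: a family closed under intersection whose intersection
  lies in an open set has a member inside that open set.
\<close>

lemma compact_Inter_subset_open:
  assumes "compact_space X" "\<F> \<noteq> {}" and cl: "\<And>F. F \<in> \<F> \<Longrightarrow> closedin X F"
    and int: "\<And>F F'. F \<in> \<F> \<Longrightarrow> F' \<in> \<F> \<Longrightarrow> F \<inter> F' \<in> \<F>"
    and U: "openin X U" and sub: "\<Inter>\<F> \<subseteq> U"
  obtains F where "F \<in> \<F>" "F \<subseteq> U"
proof (rule ccontr)
  assume "\<not> thesis"
  with that have neg: "\<And>F. F \<in> \<F> \<Longrightarrow> F - U \<noteq> {}"
    by blast
  have fin: "\<Inter>\<E> \<noteq> {}" if "finite \<E>" "\<E> \<subseteq> (\<lambda>F. F - U) ` \<F>" for \<E>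
  proof (cases "\<E> = {}")
    case False
    obtain \<H> where \<H>: "\<H> \<subseteq> \<F>" "finite \<H>" "\<E> = (\<lambda>F. F - U) ` \<H>"
      using \<open>finite \<E>\<close> \<open>\<E> \<subseteq> (\<lambda>F. F - U) ` \<F>\<close> by (meson finite_subset_image)
    with False have "\<Inter>\<H> \<in> \<F>"
      by (intro Inter_mem_of_Int_closed int) auto
    with neg obtain z where "z \<in> \<Inter>\<H> - U"
      by blast
    then have "z \<in> \<Inter>\<E>"
      using \<H> by auto
    then show ?thesis
      by blast
  qed auto
  have clU: "\<forall>C\<in>(\<lambda>F. F - U) ` \<F>. closedin X C"
    using cl U by (auto intro: closedin_diff)
  have "\<Inter>((\<lambda>F. F - U) ` \<F>) \<noteq> {}"
    using \<open>compact_space X\<close>[unfolded compact_space_fip] clU fin by blast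
  with sub \<open>\<F> \<noteq> {}\<close> show False
    by blast
qed

lemma compact_finite_meeting:
  assumes "compactin X K"
    and loc: "\<And>z. z \<in> K \<Longrightarrow> \<exists>U. openin X U \<and> z \<in> U \<and> finite {i \<in> I. U \<inter> V i \<noteq> {}}"
  shows "finite {i \<in> I. K \<inter> V i \<noteq> {}}"
proof -
  define \<U> where "\<U> = {U. openin X U \<and> finite {i \<in> I. U \<inter> V i \<noteq> {}}}"
  have "\<forall>U\<in>\<U>. openin X U" "K \<subseteq> \<Union>\<U>"
    using loc by (auto simp: \<U>_def)
  then obtain \<F> where \<F>: "finite \<F>" "\<F> \<subseteq> \<U>" "K \<subseteq> \<Union>\<F>"
    using \<open>compactin X K\<close> unfolding compactin_def by meson
  have "{i \<in> I. K \<inter> V i \<noteq> {}} \<subseteq> (\<Union>U\<in>\<F>. {i \<in> I. U \<inter> V i \<noteq> {}})"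
    using \<F>(3) by blast
  moreover have "finite (\<Union>U\<in>\<F>. {i \<in> I. U \<inter> V i \<noteq> {}})"
    using \<F> by (auto simp: \<U>_def)
  ultimately show ?thesis
    using finite_subset by blast
qed

lemma compact_sequence_cluster_point:
  fixes a :: "nat \<Rightarrow> 'a"
  assumes "compact_space X" "\<And>n. a n \<in> topspace X"
  obtains z where "z \<in> topspace X" "\<And>U. openin X U \<Longrightarrow> z \<in> U \<Longrightarrow> infinite {n. a n \<in> U}"
proof (rule ccontr)
  assume "\<not> thesis"
  with that have "\<exists>U. openin X U \<and> z \<in> U \<and> finite {n\<in>UNIV. U \<inter> {a n} \<noteq> {}}" if "z \<in> topspace X" for z
    using that by auto
  then have "finite {n\<in>UNIV. topspace X \<inter> {a n} \<noteq> {}}"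
    using assms(1) compact_finite_meeting[of X "topspace X" UNIV "\<lambda>n. {a n}"]
    unfolding compact_space_def by blast
  then show False
    using assms(2) by simp
qed

lemma regular_shrink:
  assumes "regular_space X" "openin X U" "x \<in> U"
  obtains V where "openin X V" "x \<in> V" "X closure_of V \<subseteq> U"
proof -
  have "closedin X (topspace X - U)" "x \<in> topspace X - (topspace X - U)"
    using assms(2,3) openin_subset[OF assms(2)] by auto
  then obtain V where V: "openin X V" "x \<in> V" "disjnt (topspace X - U) (X closure_of V)"
    using \<open>regular_space X\<close> unfolding regular_space by meson
  have "X closure_of V \<subseteq> U"
    using V(3) closure_of_subset_topspace[of X V] by (auto simp: disjnt_iff)
  with V that show ?thesis by blast
qed

section \<open>Countable networks\<close>

lemma network_onD:
  "network_on X S \<N> \<Longrightarrow> x \<in> S \<Longrightarrow> openin X U \<Longrightarrow> x \<in> U \<Longrightarrow> \<exists>A. A \<in> \<N> \<and> x \<in> A \<and> A \<inter> S \<subseteq> U"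
  unfolding network_on_def by (drule (1) bspec, drule spec[of _ U]) auto

lemma network_on_Un:
  assumes "network_on X S \<N>" "network_on X T \<M>"
  shows "network_on X (S \<union> T) ((\<lambda>A. A \<inter> S) ` \<N> \<union> (\<lambda>A. A \<inter> T) ` \<M>)"
  unfolding network_on_def
proof (intro ballI allI impI)
  fix x U assume x: "x \<in> S \<union> T" and U: "openin X U \<and> x \<in> U"
  show "\<exists>A\<in>(\<lambda>A. A \<inter> S) ` \<N> \<union> (\<lambda>A. A \<inter> T) ` \<M>. x \<in> A \<and> A \<inter> (S \<union> T) \<subseteq> U"
  proof (cases "x \<in> S")
    case True
    then obtain A where A: "A \<in> \<N>" "x \<in> A" "A \<inter> S \<subseteq> U"
      using network_onD[OF assms(1) _ conjunct1[OF U] conjunct2[OF U]] by blast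
    then have "A \<inter> S \<in> (\<lambda>A. A \<inter> S) ` \<N> \<union> (\<lambda>A. A \<inter> T) ` \<M>" by simp
    then show ?thesis by (rule rev_bexI) (use A True in auto)
  next
    case False
    then obtain A where A: "A \<in> \<M>" "x \<in> A" "A \<inter> T \<subseteq> U"
      using network_onD[OF assms(2) _ conjunct1[OF U] conjunct2[OF U]] x by blast
    then have "A \<inter> T \<in> (\<lambda>A. A \<inter> S) ` \<N> \<union> (\<lambda>A. A \<inter> T) ` \<M>" by simp
    then show ?thesis by (rule rev_bexI) (use A False x in auto)
  qed
qed

lemma network_on_subset:
  assumes "network_on X S \<N>" "T \<subseteq> S"
  shows "network_on X T \<N>"
  unfolding network_on_def
proof (intro ballI allI impI)
  fix x U assume "x \<in> T" "openin X U \<and> x \<in> U"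
  then obtain A where "A \<in> \<N>" "x \<in> A" "A \<inter> S \<subseteq> U"
    using network_onD[OF assms(1)] assms(2) by (metis subsetD)
  with assms(2) have "x \<in> A \<and> A \<inter> T \<subseteq> U" by auto
  with \<open>A \<in> \<N>\<close> show "\<exists>A\<in>\<N>. x \<in> A \<and> A \<inter> T \<subseteq> U" by (rule rev_bexI)
qed

lemma network_on_Lindelof:
  assumes "countable \<N>" "network_on X S \<N>" "\<And>U. U \<in> \<U> \<Longrightarrow> openin X U"
  obtains \<V> where "countable \<V>" "\<V> \<subseteq> \<U>" "S \<inter> \<Union>\<U> \<subseteq> \<Union>\<V>"
proof -
  define \<A> where "\<A> = {A \<in> \<N>. \<exists>U\<in>\<U>. A \<inter> S \<subseteq> U}"
  have "\<forall>A\<in>\<A>. \<exists>U\<in>\<U>. A \<inter> S \<subseteq> U"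
    by (simp add: \<A>_def)
  then obtain f where f: "\<And>A. A \<in> \<A> \<Longrightarrow> f A \<in> \<U> \<and> A \<inter> S \<subseteq> f A"
    by metis
  show ?thesis
  proof
    show "countable (f ` \<A>)"
      using assms(1) by (auto simp: \<A>_def)
    show "f ` \<A> \<subseteq> \<U>"
      using f by blast
    show "S \<inter> \<Union>\<U> \<subseteq> \<Union>(f ` \<A>)"
    proof
      fix x assume "x \<in> S \<inter> \<Union>\<U>"
      then obtain U where U: "x \<in> S" "x \<in> U" "U \<in> \<U>" by blast
      then obtain A where A: "A \<in> \<N>" "x \<in> A" "A \<inter> S \<subseteq> U"
        using network_onD[OF assms(2) _ assms(3)] by blast
      then have "A \<in> \<A>"
        using U by (auto simp: \<A>_def)
      with f A U show "x \<in> \<Union>(f ` \<A>)"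
        by blast
    qed
  qed
qed

lemma network_on_dense_subset:
  assumes "countable \<N>" "network_on X S \<N>"
  obtains D where "countable D" "D \<subseteq> S" "\<And>U. openin X U \<Longrightarrow> U \<inter> S \<noteq> {} \<Longrightarrow> U \<inter> D \<noteq> {}"
proof -
  define D where "D = (\<lambda>A. SOME a. a \<in> A \<inter> S) ` {A\<in>\<N>. A \<inter> S \<noteq> {}}"
  have some: "(SOME a. a \<in> A \<inter> S) \<in> A \<inter> S" if "A \<inter> S \<noteq> {}" for A
    using that by (metis all_not_in_conv someI_ex)
  show ?thesis
  proof
    show "countable D"
      using assms(1) by (simp add: D_def)
    show "D \<subseteq> S"
      using some by (auto simp: D_def)
    fix U assume U: "openin X U" "U \<inter> S \<noteq> {}"
    then obtain x where "x \<in> S" "x \<in> U" by blast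
    then obtain A where A: "A \<in> \<N>" "x \<in> A" "A \<inter> S \<subseteq> U"
      using network_onD[OF assms(2) _ U(1)] by blast
    then have "A \<inter> S \<noteq> {}" using \<open>x \<in> S\<close> by blast
    with A have "(SOME a. a \<in> A \<inter> S) \<in> D"
      by (auto simp: D_def)
    then show "U \<inter> D \<noteq> {}"
      using some[OF \<open>A \<inter> S \<noteq> {}\<close>] A by blast
  qed
qed

lemma network_on_separable:
  assumes "countable \<N>" "network_on X S \<N>" "S \<subseteq> topspace X"
  shows "separable_space (subtopology X S)"
proof -
  obtain D where D: "countable D" "D \<subseteq> S" "\<And>U. openin X U \<Longrightarrow> U \<inter> S \<noteq> {} \<Longrightarrow> U \<inter> D \<noteq> {}"
    using network_on_dense_subset[OF assms(1,2)] by blast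
  have "subtopology X S closure_of D = topspace (subtopology X S)"
    unfolding dense_intersects_open openin_subtopology using D(2) D(3) by blast
  then show ?thesis
    unfolding separable_space_def using D assms(3) by (metis inf.absorb_iff2 topspace_subtopology)
qed

text \<open>
  Each pair of network members with disjoint closures contributes a Urysohn function. By regularity
  these countably many functions separate the points, so they embed the compact space into a countable
  power of the reals.
\<close>

lemma compact_Hausdorff_network_metrizable:
  assumes "compact_space X" "Hausdorff_space X" "countable \<N>" "network_on X (topspace X) \<N>"
  shows "metrizable_space X"
proof -
  have reg: "regular_space X" and norm: "normal_space X"
    using assms compact_Hausdorff_imp_regular_space compact_Hausdorff_or_regular_imp_normal_space by blast+
  define P where "P = {(A, B). A \<in> \<N> \<and> B \<in> \<N> \<and>
     disjnt (X closure_of (A \<inter> topspace X)) (X closure_of (B \<inter> topspace X))}"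
  have "P \<subseteq> \<N> \<times> \<N>" by (auto simp: P_def)
  then have cP: "countable P"
    by (rule countable_subset) (simp add: assms(3))
  have "\<exists>f. continuous_map X euclideanreal f \<and>
       (\<forall>x\<in>fst p \<inter> topspace X. f x = 0) \<and> (\<forall>x\<in>snd p \<inter> topspace X. f x = 1)" if "p \<in> P" for p
  proof -
    have "disjnt (X closure_of (fst p \<inter> topspace X)) (X closure_of (snd p \<inter> topspace X))"
      using that by (auto simp: P_def)
    then obtain f where f: "continuous_map X (top_of_set {0..1::real}) f"
      "f ` (X closure_of (fst p \<inter> topspace X)) \<subseteq> {0}" "f ` (X closure_of (snd p \<inter> topspace X)) \<subseteq> {1}"
      using Urysohn_lemma[OF norm closedin_closure_of closedin_closure_of] by (metis zero_le_one)
    have sub: "x \<in> X closure_of (A \<inter> topspace X)" if "x \<in> A \<inter> topspace X" for x A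
      using closure_of_subset[of "A \<inter> topspace X" X] that by auto
    have "continuous_map X euclideanreal f"
      using continuous_map_into_fulltopology[OF f(1)] .
    moreover have "\<forall>x\<in>fst p \<inter> topspace X. f x = 0" "\<forall>x\<in>snd p \<inter> topspace X. f x = 1"
      using f(2,3) sub by (auto simp: image_subset_iff)
    ultimately show ?thesis
      by (intro exI[of _ f]) simp
  qed
  then obtain f where f: "\<And>p. p \<in> P \<Longrightarrow> continuous_map X euclideanreal (f p)"
    "\<And>p x. p \<in> P \<Longrightarrow> x \<in> fst p \<inter> topspace X \<Longrightarrow> f p x = (0::real)"
    "\<And>p x. p \<in> P \<Longrightarrow> x \<in> snd p \<inter> topspace X \<Longrightarrow> f p x = 1"
    by metis
  define h where "h x = (\<lambda>p\<in>P. f p x)" for x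
  let ?Q = "product_topology (\<lambda>_::'a set \<times> 'a set. euclideanreal) P"
  have "continuous_map X ?Q h"
    unfolding continuous_map_componentwise by (auto simp: h_def f(1) extensional_def)
  moreover have "inj_on h (topspace X)"
  proof (rule inj_onI, rule ccontr)
    fix x y assume xy: "x \<in> topspace X" "y \<in> topspace X" "h x = h y" "x \<noteq> y"
    then obtain U V where UV: "openin X U" "openin X V" "x \<in> U" "y \<in> V" "disjnt U V"
      using assms(2) unfolding Hausdorff_space_def by meson
    obtain U' where U': "openin X U'" "x \<in> U'" "X closure_of U' \<subseteq> U"
      using regular_shrink[OF reg] UV by metis
    obtain V' where V': "openin X V'" "y \<in> V'" "X closure_of V' \<subseteq> V"
      using regular_shrink[OF reg] UV by metis
    obtain A where A: "A \<in> \<N>" "x \<in> A" "A \<inter> topspace X \<subseteq> U'"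
      using network_onD[OF assms(4) xy(1) U'(1,2)] by blast
    obtain B where B: "B \<in> \<N>" "y \<in> B" "B \<inter> topspace X \<subseteq> V'"
      using network_onD[OF assms(4) xy(2) V'(1,2)] by blast
    have "X closure_of (A \<inter> topspace X) \<subseteq> U" "X closure_of (B \<inter> topspace X) \<subseteq> V"
      using closure_of_mono A B U' V' by (metis subset_trans)+
    then have P: "(A, B) \<in> P"
      using A B UV(5) by (auto simp: P_def disjnt_iff)
    have "f (A, B) x = 0" "f (A, B) y = 1"
      using f(2)[OF P, of x] f(3)[OF P, of y] A B xy by auto
    moreover have "f (A, B) x = f (A, B) y"
      using fun_cong[OF xy(3), of "(A, B)"] P by (simp add: h_def)
    ultimately show False by simp
  qed
  moreover have "Hausdorff_space ?Q"
    by (simp add: Hausdorff_space_product_topology)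
  ultimately have "embedding_map X ?Q h"
    using assms(1) continuous_imp_embedding_map by blast
  moreover have "metrizable_space ?Q"
    unfolding metrizable_space_product_topology using cP
    by (auto simp: metrizable_space_euclidean intro: countable_subset[of _ P])
  ultimately show ?thesis
    using embedding_map_imp_homeomorphic_space homeomorphic_metrizable_space
      metrizable_space_subtopology by metis
qed

section \<open>Spaces with a quasi-diagonal\<close>

lemma separating_families_openD: "separating_families X S \<G> \<Longrightarrow> U \<in> \<G> n \<Longrightarrow> openin X U"
  unfolding separating_families_def by simp

lemma separating_families_openin_Union: "separating_families X S \<G> \<Longrightarrow> openin X (\<Union>(\<G> n))"
  by (intro openin_Union separating_families_openD)

lemma separating_familiesE:
  assumes "separating_families X S \<G>" "x \<in> S" "y \<in> S" "x \<noteq> y"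
  obtains n where "x \<in> \<Union>(\<G> n)" "\<And>U. U \<in> \<G> n \<Longrightarrow> x \<in> U \<Longrightarrow> y \<notin> U"
proof -
  have "\<exists>n. x \<in> \<Union>(\<G> n) \<and> (\<forall>U\<in>\<G> n. x \<in> U \<longrightarrow> y \<notin> U)"
    using assms unfolding separating_families_def by simp
  with that show ?thesis by auto
qed

lemma separating_families_subset:
  "separating_families X S \<G> \<Longrightarrow> T \<subseteq> S \<Longrightarrow> separating_families X T \<G>"
  unfolding separating_families_def by (simp add: subset_iff)

text \<open>
  Reuse the families of the pieces cut down to the \<open>U k\<close>; the additional families \<open>{U k}\<close>
  separate a point of \<open>U k\<close> from the points outside.
\<close>

lemma separating_families_countable_Un:
  fixes U :: "nat \<Rightarrow> 'a set"
  assumes U: "\<And>k. openin X (U k)" "S \<subseteq> (\<Union>k. U k)"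
    and sep: "\<And>k. \<exists>\<G>. separating_families X (S \<inter> U k) \<G>"
  shows "\<exists>\<G>. separating_families X S \<G>"
proof -
  obtain \<G> where \<G>: "\<And>k. separating_families X (S \<inter> U k) (\<G> k)"
    using sep by metis
  define \<H> where "\<H> m = (case prod_decode m of (k, n) \<Rightarrow>
      (if n = 0 then {U k} else (\<lambda>V. V \<inter> U k) ` \<G> k (n - 1)))" for m
  have \<H>0: "\<H> (prod_encode (k, 0)) = {U k}" for k
    by (simp add: \<H>_def)
  have \<H>Suc: "\<H> (prod_encode (k, Suc n)) = (\<lambda>V. V \<inter> U k) ` \<G> k n" for k n
    by (simp add: \<H>_def)
  have "openin X V" if V: "V \<in> \<H> m" for m V
  proof -
    obtain k n where kn: "prod_decode m = (k, n)" by fastforce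
    show ?thesis
    proof (cases "n = 0")
      case False
      with V kn obtain W where "W \<in> \<G> k (n - 1)" "V = W \<inter> U k"
        by (auto simp: \<H>_def)
      then show ?thesis
        using separating_families_openD[OF \<G>] U(1) by (simp add: openin_Int)
    qed (use V kn U(1) in \<open>simp add: \<H>_def\<close>)
  qed
  moreover have "\<exists>m. x \<in> \<Union>(\<H> m) \<and> (\<forall>V\<in>\<H> m. x \<in> V \<longrightarrow> y \<notin> V)"
    if xy: "x \<in> S" "y \<in> S" "x \<noteq> y" for x y
  proof -
    obtain k where k: "x \<in> U k"
      using xy U(2) by auto
    show ?thesis
    proof (cases "y \<in> U k")
      case True
      then obtain n where "x \<in> \<Union>(\<G> k n)" "\<And>V. V \<in> \<G> k n \<Longrightarrow> x \<in> V \<Longrightarrow> y \<notin> V"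
        using separating_familiesE[OF \<G>, of x k y] xy k by (metis IntI)
      then show ?thesis
        using k by (intro exI[of _ "prod_encode (k, Suc n)"]) (auto simp: \<H>Suc)
    next
      case False
      then show ?thesis
        using k by (intro exI[of _ "prod_encode (k, 0)"]) (simp add: \<H>0)
    qed
  qed
  ultimately have "separating_families X S \<H>"
    unfolding separating_families_def by simp
  then show ?thesis by (intro exI[of _ \<H>])
qed

text \<open>
  The structure of a Lindelof \<open>\<Sigma>\<close>-space, seen from a compactification: the members of \<open>\<C>\<close> through a
  point of \<open>S\<close> have a compact intersection that does not leave \<open>S\<close>. A compact set has the cover
  consisting of itself.
\<close>

definition Sigma_cover :: "'a topology \<Rightarrow> 'a set \<Rightarrow> 'a set set \<Rightarrow> bool" where
  "Sigma_cover X S \<C> \<longleftrightarrow> countable \<C> \<and> (\<forall>F\<in>\<C>. closedin X F) \<and>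
     (\<forall>y\<in>S. topspace X \<inter> \<Inter>{F\<in>\<C>. y \<in> F} \<subseteq> S)"

text \<open>
  If finitely many members of \<open>\<U>\<close> cover the compact intersection belonging to \<open>y\<close>, they already
  cover a finite intersection of members of \<open>\<C>\<close> through \<open>y\<close>, and there are only countably many of
  these.
\<close>

lemma Sigma_cover_Lindelof_closed:
  assumes X: "compact_space X" and \<C>: "Sigma_cover X S \<C>" and F: "closedin X F"
    and \<U>: "\<And>U. U \<in> \<U> \<Longrightarrow> openin X U" "F \<inter> S \<subseteq> \<Union>\<U>"
  obtains \<V> where "countable \<V>" "\<V> \<subseteq> \<U>" "F \<inter> S \<subseteq> \<Union>\<V>"
proof -
  have \<C>': "countable \<C>" "\<And>E. E \<in> \<C> \<Longrightarrow> closedin X E" "\<And>y. y \<in> S \<Longrightarrow> topspace X \<inter> \<Inter>{E\<in>\<C>. y \<in> E} \<subseteq> S"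
    using \<C> unfolding Sigma_cover_def by auto
  \<comment> \<open>The finite subfamilies whose intersection, within \<open>F\<close>, is finitely covered.\<close>
  define Good where "Good = {\<H>. finite \<H> \<and> \<H> \<subseteq> \<C> \<and> (\<exists>\<W>. finite \<W> \<and> \<W> \<subseteq> \<U> \<and> F \<inter> \<Inter>\<H> \<subseteq> \<Union>\<W>)}"
  have "\<forall>\<H>\<in>Good. \<exists>\<W>. finite \<W> \<and> \<W> \<subseteq> \<U> \<and> F \<inter> \<Inter>\<H> \<subseteq> \<Union>\<W>"
    unfolding Good_def by simp
  then obtain \<W> where \<W>: "\<And>\<H>. \<H> \<in> Good \<Longrightarrow> finite (\<W> \<H>) \<and> \<W> \<H> \<subseteq> \<U> \<and> F \<inter> \<Inter>\<H> \<subseteq> \<Union>(\<W> \<H>)"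
    by metis
  have "countable Good"
    by (rule countable_subset[OF _ countable_Collect_finite_subset[OF \<C>'(1)]]) (auto simp: Good_def)
  then have "countable (\<Union>(\<W> ` Good))"
    using \<W> by (intro countable_UN) (auto intro: countable_finite)
  moreover have "\<Union>(\<W> ` Good) \<subseteq> \<U>"
    using \<W> by (simp add: UN_subset_iff)
  moreover have "F \<inter> S \<subseteq> \<Union>(\<Union>(\<W> ` Good))"
  proof
    fix y assume y: "y \<in> F \<inter> S"
    define \<F> where "\<F> = {F \<inter> \<Inter>\<H> |\<H>. finite \<H> \<and> \<H> \<subseteq> \<C> \<and> y \<in> \<Inter>\<H>}"
    have "F \<in> \<F>"
      unfolding \<F>_def by (intro CollectI exI[of _ "{}"]) auto
    have cl: "closedin X E" if "E \<in> \<F>" for E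
    proof -
      obtain \<H> where \<H>: "finite \<H>" "\<H> \<subseteq> \<C>" "E = F \<inter> \<Inter>\<H>"
        using \<open>E \<in> \<F>\<close> unfolding \<F>_def mem_Collect_eq by metis
      have "closedin X (\<Inter>(insert F \<H>))"
        using \<H>(2) F \<C>'(2) by (intro closedin_Inter) auto
      then show ?thesis
        using \<H>(3) by simp
    qed
    have int: "E \<inter> E' \<in> \<F>" if "E \<in> \<F>" "E' \<in> \<F>" for E E'
    proof -
      obtain \<H> \<H>' where \<H>: "finite \<H>" "\<H> \<subseteq> \<C>" "y \<in> \<Inter>\<H>" "E = F \<inter> \<Inter>\<H>"
        "finite \<H>'" "\<H>' \<subseteq> \<C>" "y \<in> \<Inter>\<H>'" "E' = F \<inter> \<Inter>\<H>'"
        using \<open>E \<in> \<F>\<close> \<open>E' \<in> \<F>\<close> unfolding \<F>_def mem_Collect_eq by metis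
      show ?thesis
        unfolding \<F>_def by (intro CollectI exI[of _ "\<H> \<union> \<H>'"]) (use \<H> in auto)
    qed
    have "\<Inter>\<F> \<subseteq> F \<inter> S"
    proof
      fix z assume z: "z \<in> \<Inter>\<F>"
      have "z \<in> E" if "E \<in> \<C>" "y \<in> E" for E
      proof -
        have "F \<inter> \<Inter>{E} \<in> \<F>"
          unfolding \<F>_def using that by (intro CollectI exI[of _ "{E}"]) auto
        with z show ?thesis by auto
      qed
      then have "z \<in> \<Inter>{E\<in>\<C>. y \<in> E}"
        by simp
      moreover have "z \<in> F"
        using z \<open>F \<in> \<F>\<close> by simp
      moreover from this have "z \<in> topspace X"
        using closedin_subset[OF F] by (rule rev_subsetD)
      moreover have "y \<in> S"
        using y by simp
      ultimately show "z \<in> F \<inter> S"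
        using subsetD[OF \<C>'(3)[of y], of z] by simp
    qed
    then have sub: "\<Inter>\<F> \<subseteq> \<Union>\<U>"
      using \<U>(2) by (rule subset_trans)
    have "closedin X (\<Inter>\<F>)"
      using cl \<open>F \<in> \<F>\<close> by (intro closedin_Inter) auto
    then have "compactin X (\<Inter>\<F>)"
      using X closedin_compact_space by metis
    then obtain \<W>' where \<W>': "finite \<W>'" "\<W>' \<subseteq> \<U>" "\<Inter>\<F> \<subseteq> \<Union>\<W>'"
      using sub \<U>(1) unfolding compactin_def by metis
    have "openin X (\<Union>\<W>')"
      using \<U>(1) \<W>'(2) by (intro openin_Union) auto
    moreover have "\<F> \<noteq> {}"
      using \<open>F \<in> \<F>\<close> by auto
    ultimately obtain E where "E \<in> \<F>" "E \<subseteq> \<Union>\<W>'"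
      using compact_Inter_subset_open[OF X _ cl int _ \<W>'(3)] by metis
    then obtain \<H> where \<H>: "finite \<H>" "\<H> \<subseteq> \<C>" "y \<in> \<Inter>\<H>" "F \<inter> \<Inter>\<H> \<subseteq> \<Union>\<W>'"
      unfolding \<F>_def by auto
    then have "\<H> \<in> Good"
      using \<W>' unfolding Good_def by (intro CollectI conjI exI[of _ \<W>'])
    moreover from this have "y \<in> \<Union>(\<W> \<H>)"
      using \<W>[of \<H>] y \<H>(3) by auto
    ultimately show "y \<in> \<Union>(\<Union>(\<W> ` Good))"
      by auto
  qed
  ultimately show ?thesis
    by (rule that)
qed

text \<open>
  Close \<open>\<C>\<close> under intersection, adjoining the complements of the sets \<open>\<Union>(\<G> n)\<close> and, whenever \<open>F\<close> in
  the family is covered by \<open>\<G> n\<close>, the complements of countably many members of \<open>\<G> n\<close> that cover it.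
  The resulting countable family \<open>M\<close> is a network. For \<open>w \<in> S\<close> let \<open>K\<close> be the intersection of the
  members through \<open>w\<close>, and remove from \<open>K\<close> one after the other the sets \<open>\<Union>(\<G> n)\<close>, skipping
  those that would remove everything. What survives is nonempty. If \<open>z\<close> survives and lies in
  \<open>\<Union>(\<G> n)\<close>, then step \<open>n\<close> was skipped, so that some member of \<open>M\<close> through \<open>w\<close>, intersected with
  what the earlier steps leave, is covered by \<open>\<G> n\<close>; one of the chosen covering sets contains \<open>z\<close>, and it
  must contain \<open>w\<close> since otherwise its complement would exclude \<open>z\<close> from \<open>K\<close>. Thus no \<open>n\<close> separates
  \<open>z\<close> from \<open>w\<close>, and \<open>z = w\<close>. Therefore \<open>w\<close> itself survives, so no removal took place inside \<open>K\<close>, every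
  point of \<open>K\<close> survives, and \<open>K = {w}\<close>.
\<close>

lemma separating_families_network:
  assumes X: "compact_space X" and \<C>: "Sigma_cover X S \<C>" and S: "S \<subseteq> topspace X"
    and \<G>: "separating_families X S \<G>"
  obtains \<N> where "countable \<N>" "network_on X S \<N>"
proof -
  have \<C>': "countable \<C>" "\<And>E. E \<in> \<C> \<Longrightarrow> closedin X E" "\<And>y. y \<in> S \<Longrightarrow> topspace X \<inter> \<Inter>{E\<in>\<C>. y \<in> E} \<subseteq> S"
    using \<C> unfolding Sigma_cover_def by auto
  have "\<exists>\<V>. countable \<V> \<and> \<V> \<subseteq> \<G> n \<and> (closedin X F \<and> F \<inter> S \<subseteq> \<Union>(\<G> n) \<longrightarrow> F \<inter> S \<subseteq> \<Union>\<V>)" for F n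
  proof (cases "closedin X F \<and> F \<inter> S \<subseteq> \<Union>(\<G> n)")
    case True
    then show ?thesis
      using Sigma_cover_Lindelof_closed[OF X \<C>, of F "\<G> n"] separating_families_openD[OF \<G>] by metis
  qed (intro exI[of _ "{}"], auto)
  then have "\<forall>F. \<forall>n. \<exists>\<V>. countable \<V> \<and> \<V> \<subseteq> \<G> n \<and> (closedin X F \<and> F \<inter> S \<subseteq> \<Union>(\<G> n) \<longrightarrow> F \<inter> S \<subseteq> \<Union>\<V>)"
    by simp
  then obtain \<V> where "\<forall>F. \<forall>n. countable (\<V> F n) \<and> \<V> F n \<subseteq> \<G> n \<and>
      (closedin X F \<and> F \<inter> S \<subseteq> \<Union>(\<G> n) \<longrightarrow> F \<inter> S \<subseteq> \<Union>(\<V> F n))"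
    unfolding choice_iff by (elim exE)
  then have \<V>: "\<And>F n. countable (\<V> F n)" "\<And>F n. \<V> F n \<subseteq> \<G> n"
    and \<V>_cover: "\<And>F n. closedin X F \<Longrightarrow> F \<inter> S \<subseteq> \<Union>(\<G> n) \<Longrightarrow> F \<inter> S \<subseteq> \<Union>(\<V> F n)"
    by simp_all
  define g where "g F F' = insert (F \<inter> F') (\<Union>n. (\<lambda>U. topspace X - U) ` \<V> F n)" for F F'
  define \<A> where "\<A> = insert (topspace X) (\<C> \<union> range (\<lambda>n. topspace X - \<Union>(\<G> n)))"
  have "countable \<A>" and gcount: "\<And>F F'. countable (g F F')"
    using \<C>'(1) \<V>(1) by (auto simp: \<A>_def g_def)
  then obtain L where L: "countable L" "\<A> \<subseteq> L" "\<And>F F'. F \<in> L \<Longrightarrow> F' \<in> L \<Longrightarrow> g F F' \<subseteq> L"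
    using countable_binary_closure[of \<A> g] by metis
  define M where "M = {F\<in>L. closedin X F}"
  have "countable M"
    using L(1) by (simp add: M_def)
  have cl: "closedin X F" if "F \<in> M" for F
    using that by (simp add: M_def)
  have int: "F \<inter> F' \<in> M" if "F \<in> M" "F' \<in> M" for F F'
    using that L(3)[of F F'] by (simp add: M_def g_def closedin_Int)
  have top: "topspace X \<in> M"
    using L(2) by (simp add: M_def \<A>_def)
  have \<C>M: "F \<in> M" if "F \<in> \<C>" for F
    using that L(2) \<C>'(2) by (auto simp: M_def \<A>_def)
  have GM: "topspace X - \<Union>(\<G> n) \<in> M" for n
    using L(2) separating_families_openin_Union[OF \<G>] by (auto simp: M_def \<A>_def image_subset_iff)
  have VM: "topspace X - U \<in> M" if "F \<in> M" "U \<in> \<V> F n" for F U n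
  proof -
    have "topspace X - U \<in> g F F"
      using that by (auto simp: g_def)
    then have "topspace X - U \<in> L"
      using L(3)[of F F] that(1) unfolding M_def by auto
    moreover have "openin X U"
      using \<V>(2) that separating_families_openD[OF \<G>] by (metis subsetD)
    ultimately show ?thesis
      by (auto simp: M_def)
  qed
  have "\<exists>F\<in>M. w \<in> F \<and> F \<subseteq> U" if w: "w \<in> S" and U: "openin X U" "w \<in> U" for w U
  proof -
    define \<K> where "\<K> = {F\<in>M. w \<in> F}"
    define K where "K = \<Inter>\<K>"
    have top\<K>: "topspace X \<in> \<K>"
      using top w S by (auto simp: \<K>_def)
    have K_cl: "closedin X K"
      unfolding K_def using cl top\<K> by (intro closedin_Inter) (auto simp: \<K>_def)
    have wK: "w \<in> K"
      by (simp add: K_def \<K>_def)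
    have "K \<subseteq> topspace X \<inter> \<Inter>{E\<in>\<C>. w \<in> E}"
      using top\<K> \<C>M unfolding K_def \<K>_def by auto
    then have KS: "K \<subseteq> S"
      using \<C>'(3)[OF w] by (rule subset_trans)
    \<comment> \<open>\<open>K \<inter> A n\<close> is what is left of \<open>K\<close> after the first \<open>n\<close> removals.\<close>
    define A where "A = rec_nat (topspace X)
       (\<lambda>n B. if K \<inter> B - \<Union>(\<G> n) \<noteq> {} then B \<inter> (topspace X - \<Union>(\<G> n)) else B)"
    have A0: "A 0 = topspace X" and
      ASuc: "\<And>n. A (Suc n) = (if K \<inter> A n - \<Union>(\<G> n) \<noteq> {} then A n \<inter> (topspace X - \<Union>(\<G> n)) else A n)"
      by (simp_all add: A_def)
    have AM: "A n \<in> M" for n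
      by (induction n) (simp_all add: A0 ASuc top int GM)
    have KA: "K \<inter> A n \<noteq> {}" for n
    proof (induction n)
      case 0
      then show ?case
        using wK w S by (auto simp: A0)
    next
      case (Suc n)
      then show ?case
        using closedin_subset[OF K_cl] by (auto simp: ASuc)
    qed
    have Adec: "A (Suc n) \<subseteq> A n" for n
      by (auto simp: ASuc)
    have only: "z = w" if z: "z \<in> K" "\<And>n. z \<in> A n" for z
    proof (rule ccontr)
      assume "z \<noteq> w"
      then obtain n where n: "z \<in> \<Union>(\<G> n)" "\<And>U. U \<in> \<G> n \<Longrightarrow> z \<in> U \<Longrightarrow> w \<notin> U"
        using separating_familiesE[OF \<G>, of z w] z KS w by (metis subsetD)
      have "K \<inter> A n \<subseteq> \<Union>(\<G> n)"
        using z(2)[of "Suc n"] n(1) by (auto simp: ASuc split: if_splits)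
      moreover have "\<Inter>((\<lambda>F. F \<inter> A n) ` \<K>) = K \<inter> A n"
        using top\<K> by (auto simp: K_def)
      ultimately have sub: "\<Inter>((\<lambda>F. F \<inter> A n) ` \<K>) \<subseteq> \<Union>(\<G> n)"
        by simp
      obtain F where F: "F \<in> \<K>" "F \<inter> A n \<subseteq> \<Union>(\<G> n)"
      proof (rule compact_Inter_subset_open[OF X _ _ _ separating_families_openin_Union[OF \<G>] sub])
        show "(\<lambda>F. F \<inter> A n) ` \<K> \<noteq> {}"
          using top\<K> by auto
        show "closedin X F" if "F \<in> (\<lambda>F. F \<inter> A n) ` \<K>" for F
          using that AM cl by (auto simp: \<K>_def)
        show "F \<inter> F' \<in> (\<lambda>F. F \<inter> A n) ` \<K>"
          if FF': "F \<in> (\<lambda>F. F \<inter> A n) ` \<K>" "F' \<in> (\<lambda>F. F \<inter> A n) ` \<K>" for F F'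
        proof -
          obtain E E' where E: "E \<in> \<K>" "E' \<in> \<K>" "F = E \<inter> A n" "F' = E' \<inter> A n"
            using FF' by auto
          then have "F \<inter> F' = (E \<inter> E') \<inter> A n" "E \<inter> E' \<in> \<K>"
            using int by (auto simp: \<K>_def)
          then show ?thesis by (metis image_eqI)
        qed
      qed auto
      have FM: "F \<inter> A n \<in> M"
        using F(1) AM int by (simp add: \<K>_def)
      have "z \<in> F \<inter> A n \<inter> S"
        using z F(1) KS by (auto simp: K_def)
      moreover have "F \<inter> A n \<inter> S \<subseteq> \<Union>(\<V> (F \<inter> A n) n)"
        using \<V>_cover[OF cl[OF FM], of n] F(2) by auto
      ultimately obtain V where V: "V \<in> \<V> (F \<inter> A n) n" "z \<in> V"
        by auto
      then have "w \<notin> V"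
        using n(2) \<V>(2) by (metis subsetD)
      then have "topspace X - V \<in> \<K>"
        using VM[OF FM V(1)] w S by (auto simp: \<K>_def)
      then show False
        using z(1) V(2) by (auto simp: K_def)
    qed
    have "\<exists>z. z \<in> K \<and> (\<forall>n. z \<in> A n)"
    proof (rule ccontr)
      assume neg: "\<nexists>z. z \<in> K \<and> (\<forall>n. z \<in> A n)"
      have sub: "\<Inter>(range (\<lambda>n. K \<inter> A n)) \<subseteq> {}"
        using neg by auto
      have dec: "A n \<subseteq> A m" if "m \<le> n" for m n
        using lift_Suc_antimono_le[of A, OF Adec that] .
      obtain F where "F \<in> range (\<lambda>n. K \<inter> A n)" "F \<subseteq> {}"
      proof (rule compact_Inter_subset_open[OF X _ _ _ openin_empty sub])
        show "closedin X F" if "F \<in> range (\<lambda>n. K \<inter> A n)" for F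
          using that AM cl K_cl by auto
        show "F \<inter> F' \<in> range (\<lambda>n. K \<inter> A n)"
          if FF': "F \<in> range (\<lambda>n. K \<inter> A n)" "F' \<in> range (\<lambda>n. K \<inter> A n)" for F F'
        proof -
          obtain i j where "F = K \<inter> A i" "F' = K \<inter> A j"
            using FF' by auto
          then have "F \<inter> F' = K \<inter> A (max i j)"
            using dec[of i "max i j"] dec[of j "max i j"]
            by (cases "i \<le> j") (auto simp: max_def)
          then show ?thesis by simp
        qed
      qed auto
      then show False
        using KA by auto
    qed
    then have wA: "w \<in> A n" for n
      using only by auto
    have "K \<subseteq> A n" for n
      using AM[of n] wA[of n] unfolding K_def \<K>_def by auto
    then have "K \<subseteq> {w}"
      using only by (intro subsetI) (metis singletonI subsetD)
    then have "\<Inter>\<K> \<subseteq> U"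
      using U by (auto simp: K_def)
    then obtain F where "F \<in> \<K>" "F \<subseteq> U"
    proof (rule compact_Inter_subset_open[OF X _ _ _ U(1), rotated 3])
      show "\<K> \<noteq> {}" using top\<K> by auto
    qed (auto simp: \<K>_def cl int)
    then show ?thesis
      by (auto simp: \<K>_def)
  qed
  then have "network_on X S M"
    unfolding network_on_def by (metis inf.coboundedI1)
  with \<open>countable M\<close> show ?thesis
    by (rule that)
qed

text \<open>
  The network makes every \<open>F \<inter> \<Union>(\<G> n)\<close> Lindelof, so countably many members of the \<open>\<G> n\<close> suffice
  to separate each point of \<open>F\<close> from each point outside; finite unions of them that cover \<open>F\<close> then
  exclude any given point of \<open>S - F\<close>.
\<close>

lemma compact_countable_pseudocharacter:
  assumes F: "compactin X F" "F \<subseteq> S" and \<G>: "separating_families X S \<G>"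
    and \<N>: "countable \<N>" "network_on X F \<N>"
  obtains P :: "nat \<Rightarrow> 'a set" where "\<And>n. openin X (P n)" "\<And>n. F \<subseteq> P n"
    "\<And>x. x \<in> S - F \<Longrightarrow> \<exists>n. x \<notin> P n"
proof -
  have "\<exists>\<V>. countable \<V> \<and> \<V> \<subseteq> \<G> n \<and> F \<inter> \<Union>(\<G> n) \<subseteq> \<Union>\<V>" for n
    using network_on_Lindelof[OF \<N>, of "\<G> n"] separating_families_openD[OF \<G>] by metis
  then obtain \<V> where \<V>: "\<And>n. countable (\<V> n)" "\<And>n. \<V> n \<subseteq> \<G> n" "\<And>n. F \<inter> \<Union>(\<G> n) \<subseteq> \<Union>(\<V> n)"
    by metis
  define \<W> where "\<W> = (\<Union>n. \<V> n)"
  have \<W>: "countable \<W>" "\<And>U. U \<in> \<W> \<Longrightarrow> openin X U"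
    using \<V>(1,2) separating_families_openD[OF \<G>] by (auto simp: \<W>_def dest!: subsetD[OF \<V>(2)])
  define \<P> where "\<P> = insert (topspace X) {\<Union>\<H> |\<H>. finite \<H> \<and> \<H> \<subseteq> \<W> \<and> F \<subseteq> \<Union>\<H>}"
  have "countable ((\<lambda>\<H>. \<Union>\<H>) ` {\<H>. finite \<H> \<and> \<H> \<subseteq> \<W>})"
    using countable_Collect_finite_subset[OF \<W>(1)] by simp
  moreover have "\<P> \<subseteq> insert (topspace X) ((\<lambda>\<H>. \<Union>\<H>) ` {\<H>. finite \<H> \<and> \<H> \<subseteq> \<W>})"
    by (auto simp: \<P>_def)
  ultimately have "countable \<P>"
    by (meson countable_insert countable_subset)
  have \<P>: "openin X P" "F \<subseteq> P" if "P \<in> \<P>" for P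
    using that compactin_subset_topspace[OF F(1)] \<W>(2) by (auto simp: \<P>_def subset_iff)
  have sep: "\<exists>P\<in>\<P>. x \<notin> P" if x: "x \<in> S - F" for x
  proof -
    define \<U> where "\<U> = {U\<in>\<W>. x \<notin> U}"
    have "F \<subseteq> \<Union>\<U>"
    proof
      fix f assume f: "f \<in> F"
      with x have "f \<in> S" "x \<in> S" "f \<noteq> x"
        using F(2) by auto
      then obtain n where n: "f \<in> \<Union>(\<G> n)" "\<And>U. U \<in> \<G> n \<Longrightarrow> f \<in> U \<Longrightarrow> x \<notin> U"
        using separating_familiesE[OF \<G>] by metis
      then obtain U where "U \<in> \<V> n" "f \<in> U"
        using \<V>(3)[of n] f by auto
      then show "f \<in> \<Union>\<U>"
        using n(2) \<V>(2) by (auto simp: \<U>_def \<W>_def)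
    qed
    moreover have "\<forall>U\<in>\<U>. openin X U"
      using \<W>(2) by (simp add: \<U>_def)
    ultimately obtain \<H> where \<H>: "finite \<H>" "\<H> \<subseteq> \<U>" "F \<subseteq> \<Union>\<H>"
      using F(1) unfolding compactin_def by metis
    then have "\<Union>\<H> \<in> \<P>" "x \<notin> \<Union>\<H>"
      by (auto simp: \<P>_def \<U>_def)
    then show ?thesis by (rule bexI[rotated])
  qed
  have ne: "\<P> \<noteq> {}"
    by (simp add: \<P>_def)
  show ?thesis
  proof
    show "openin X (from_nat_into \<P> n)" "F \<subseteq> from_nat_into \<P> n" for n
      using \<P> from_nat_into[OF ne] by auto
    show "\<exists>n. x \<notin> from_nat_into \<P> n" if "x \<in> S - F" for x
      using sep[OF that] from_nat_into_surj[OF \<open>countable \<P>\<close>] by metis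
  qed
qed

text \<open>
  Chaber's argument. Extend a family of closed sets with the finite intersection property to a maximal
  one, \<open>M\<close>; countable compactness makes \<open>M\<close> closed under countable intersections. For each \<open>n\<close> some
  member of \<open>M\<close> either misses \<open>\<Union>(\<G> n)\<close> or lies inside it (\<open>b n\<close>). In the latter case,
  the set \<open>H n\<close> of points \<open>x\<close> whose star is avoided by a member of \<open>M\<close> cannot meet all members of
  \<open>M\<close>: otherwise one could choose a sequence in it whose points lie outside the stars of
  their predecessors, and a cluster point of the sequence would have a neighbourhood in \<open>\<G> n\<close> that
  contains two of its terms. So some \<open>x\<close> in the intersection of countably many members lies in no
  \<open>H n\<close>. All nonempty stars of \<open>x\<close> then contain the
  traces on \<open>S\<close> of members of \<open>M\<close>, which have at most \<open>x\<close> in common; so their intersection is \<open>{x}\<close>, and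
  \<open>x\<close> lies in every set of the original family.
\<close>

lemma countably_compact_separating_imp_compact:
  assumes S: "S \<subseteq> topspace X" and \<G>: "separating_families X S \<G>"
    and cc: "\<And>a :: nat \<Rightarrow> 'a. range a \<subseteq> S \<Longrightarrow> \<exists>z\<in>S. \<forall>U. openin X U \<and> z \<in> U \<longrightarrow> infinite {n. a n \<in> U}"
  shows "compactin X S"
proof -
  have "S \<inter> \<Inter>\<U> \<noteq> {}"
    if \<U>: "\<forall>C\<in>\<U>. closedin X C" "\<And>\<F>. finite \<F> \<Longrightarrow> \<F> \<subseteq> \<U> \<Longrightarrow> S \<inter> \<Inter>\<F> \<noteq> {}" for \<U>
  proof -
    define \<AA> where "\<AA> = {M. \<U> \<subseteq> M \<and> (\<forall>C\<in>M. closedin X C) \<and> (\<forall>\<F>. finite \<F> \<and> \<F> \<subseteq> M \<longrightarrow> S \<inter> \<Inter>\<F> \<noteq> {})}"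
    have "\<exists>M\<in>\<AA>. \<forall>M'\<in>\<AA>. M \<subseteq> M' \<longrightarrow> M' = M"
    proof (rule subset_Zorn_nonempty)
      show "\<AA> \<noteq> {}"
        using \<U> unfolding \<AA>_def by auto
      fix \<C> assume \<C>: "\<C> \<noteq> {}" "subset.chain \<AA> \<C>"
      then have \<C>\<AA>: "\<And>M. M \<in> \<C> \<Longrightarrow> M \<in> \<AA>"
        unfolding subset.chain_def by auto
      have "S \<inter> \<Inter>\<F> \<noteq> {}" if \<F>: "finite \<F>" "\<F> \<subseteq> \<Union>\<C>" for \<F>
      proof -
        obtain M where "M \<in> \<C>" "\<F> \<subseteq> M"
          using finite_subset_Union_chain[OF \<F> \<C>] by metis
        then show ?thesis
          using \<C>\<AA>[of M] \<F>(1) unfolding \<AA>_def by simp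
      qed
      moreover have "\<U> \<subseteq> \<Union>\<C>"
      proof -
        obtain M where "M \<in> \<C>" using \<C>(1) by auto
        then show ?thesis
          using \<C>\<AA>[of M] unfolding \<AA>_def by auto
      qed
      moreover have "\<forall>C\<in>\<Union>\<C>. closedin X C"
        using \<C>\<AA> unfolding \<AA>_def by auto
      ultimately show "\<Union>\<C> \<in> \<AA>"
        unfolding \<AA>_def by simp
    qed
    then obtain M where M: "M \<in> \<AA>" "\<And>M'. M' \<in> \<AA> \<Longrightarrow> M \<subseteq> M' \<Longrightarrow> M' = M"
      by metis
    have \<U>M: "\<And>C. C \<in> \<U> \<Longrightarrow> C \<in> M" and clM: "\<And>C. C \<in> M \<Longrightarrow> closedin X C"
      and fipM: "\<And>\<F>. finite \<F> \<Longrightarrow> \<F> \<subseteq> M \<Longrightarrow> S \<inter> \<Inter>\<F> \<noteq> {}"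
      using M(1) unfolding \<AA>_def by auto
    have memI: "E \<in> M" if E: "closedin X E" "\<And>\<F>. finite \<F> \<Longrightarrow> \<F> \<subseteq> M \<Longrightarrow> S \<inter> E \<inter> \<Inter>\<F> \<noteq> {}" for E
    proof -
      have "S \<inter> \<Inter>\<F> \<noteq> {}" if \<F>: "finite \<F>" "\<F> \<subseteq> insert E M" for \<F>
      proof -
        have "S \<inter> E \<inter> \<Inter>(\<F> - {E}) \<noteq> {}"
          using \<F> by (intro E(2)) auto
        moreover have "S \<inter> E \<inter> \<Inter>(\<F> - {E}) \<subseteq> S \<inter> \<Inter>\<F>"
          by auto
        ultimately show ?thesis by auto
      qed
      then have "insert E M \<in> \<AA>"
        using M(1) E(1) unfolding \<AA>_def by (simp add: subset_insertI2)
      then have "insert E M = M"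
        by (rule M(2)) (simp add: subset_insertI)
      then show ?thesis by auto
    qed
    have topM: "topspace X \<in> M"
    proof (rule memI)
      fix \<F> assume "finite \<F>" "\<F> \<subseteq> M"
      then have "S \<inter> \<Inter>\<F> \<noteq> {}" by (rule fipM)
      then show "S \<inter> topspace X \<inter> \<Inter>\<F> \<noteq> {}" using S by auto
    qed simp
    have InterM: "topspace X \<inter> \<Inter>\<F> \<in> M" if \<F>: "finite \<F>" "\<F> \<subseteq> M" for \<F>
    proof (rule memI)
      have "closedin X (\<Inter>(insert (topspace X) \<F>))"
        using \<F> clM by (intro closedin_Inter) auto
      then show "closedin X (topspace X \<inter> \<Inter>\<F>)" by simp
      fix \<E> assume "finite \<E>" "\<E> \<subseteq> M"
      then have "S \<inter> \<Inter>(\<F> \<union> \<E>) \<noteq> {}" using \<F> by (intro fipM) auto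
      then show "S \<inter> (topspace X \<inter> \<Inter>\<F>) \<inter> \<Inter>\<E> \<noteq> {}" using S by auto
    qed
    have notM: "\<exists>D\<in>M. S \<inter> E \<inter> D = {}" if E: "closedin X E" "E \<notin> M" for E
    proof -
      obtain \<F> where "finite \<F>" "\<F> \<subseteq> M" "S \<inter> E \<inter> \<Inter>\<F> = {}"
        using memI[OF E(1)] E(2) by metis
      then show ?thesis
        using InterM[of \<F>] by (intro bexI[of _ "topspace X \<inter> \<Inter>\<F>"]) auto
    qed
    have INTM: "(\<Inter>k. E k) \<in> M" if E: "\<And>k. E k \<in> M" for E :: "nat \<Rightarrow> 'a set"
    proof (rule memI)
      show "closedin X (\<Inter>k. E k)"
        using clM E by (intro closedin_INT) auto
      fix \<F> assume \<F>: "finite \<F>" "\<F> \<subseteq> M"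
      have "S \<inter> \<Inter>(\<F> \<union> E ` {..k}) \<noteq> {}" for k
        using \<F> E by (intro fipM) auto
      then have "\<forall>k. \<exists>x. x \<in> S \<inter> \<Inter>(\<F> \<union> E ` {..k})"
        by (simp only: ex_in_conv) simp
      then obtain a where a: "\<And>k. a k \<in> S \<inter> \<Inter>(\<F> \<union> E ` {..k})"
        by metis
      then obtain z where z: "z \<in> S" "\<And>U. openin X U \<Longrightarrow> z \<in> U \<Longrightarrow> infinite {n. a n \<in> U}"
        using cc[of a] by (metis IntD1 image_subsetI)
      have zC: "z \<in> C" if C: "closedin X C" "\<And>k. k \<ge> k0 \<Longrightarrow> a k \<in> C" for C k0
      proof (rule ccontr)
        assume "z \<notin> C"
        then have "infinite {n. a n \<in> topspace X - C}"
          using z S C(1) by (intro z(2)) auto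
        moreover have "{n. a n \<in> topspace X - C} \<subseteq> {..<k0}"
          using C(2) by (auto simp: not_le[symmetric])
        ultimately show False
          using finite_subset by auto
      qed
      have "z \<in> C" if "C \<in> \<F>" for C
        using that a \<F> clM by (intro zC[of C 0]) auto
      moreover have "z \<in> E k" for k
        using a E clM by (intro zC[of _ k]) auto
      ultimately show "S \<inter> (\<Inter>k. E k) \<inter> \<Inter>\<F> \<noteq> {}"
        using z(1) by auto
    qed
    define st where "st x n = \<Union>{U\<in>\<G> n. x \<in> U}" for x n
    have st_open: "openin X (st x n)" for x n
      unfolding st_def using separating_families_openD[OF \<G>] by (intro openin_Union) auto
    define b where "b n \<longleftrightarrow> topspace X - \<Union>(\<G> n) \<notin> M" for n
    have "\<exists>D\<in>M. if b n then S \<inter> D \<subseteq> \<Union>(\<G> n) else D \<inter> \<Union>(\<G> n) = {}" for n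
    proof (cases "b n")
      case True
      have "closedin X (topspace X - \<Union>(\<G> n))"
        using separating_families_openin_Union[OF \<G>] by auto
      then obtain D where "D \<in> M" "S \<inter> (topspace X - \<Union>(\<G> n)) \<inter> D = {}"
        using notM True by (metis b_def)
      then show ?thesis
        using True S by (intro bexI[of _ D]) auto
    next
      case False
      then show ?thesis
        by (intro bexI[of _ "topspace X - \<Union>(\<G> n)"]) (auto simp: b_def)
    qed
    then obtain F where FM: "\<And>n. F n \<in> M"
      and Fb: "\<And>n. b n \<Longrightarrow> S \<inter> F n \<subseteq> \<Union>(\<G> n)" and Fnb: "\<And>n. \<not> b n \<Longrightarrow> F n \<inter> \<Union>(\<G> n) = {}"
      by metis
    define F0 where "F0 = (\<Inter>n. F n)"
    have F0M: "F0 \<in> M"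
      unfolding F0_def by (rule INTM[OF FM])
    define H where "H n = {x\<in>S \<inter> F0. topspace X - st x n \<in> M}" for n
    have "\<exists>E\<in>M. E \<inter> H n = {}" if "b n" for n
    proof (rule ccontr)
      assume "\<not> (\<exists>E\<in>M. E \<inter> H n = {})"
      then have meet: "E \<inter> H n \<noteq> {}" if "E \<in> M" for E
        using that by auto
      have "\<exists>a. \<forall>k::nat. a k \<in> H n \<and> (\<forall>i<k. a k \<notin> st (a i) n)"
      proof (rule dependent_wellorder_choice)
        fix k :: nat and f assume f: "\<And>i. i < k \<Longrightarrow> f i \<in> H n \<and> (\<forall>j<i. f i \<notin> st (f j) n)"
        have "topspace X \<inter> \<Inter>((\<lambda>i. topspace X - st (f i) n) ` {..<k}) \<in> M"
          using f by (intro InterM) (auto simp: H_def)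
        from meet[OF this] show "\<exists>r. r \<in> H n \<and> (\<forall>i<k. r \<notin> st (f i) n)"
          by (auto split: if_splits)
      qed auto
      then obtain a where "\<forall>k::nat. a k \<in> H n \<and> (\<forall>i<k. a k \<notin> st (a i) n)"
        by (rule exE)
      then have a: "\<And>k. a k \<in> H n" "\<And>i k. i < k \<Longrightarrow> a k \<notin> st (a i) n"
        by simp_all
      then have "range a \<subseteq> S"
        by (auto simp: H_def)
      then obtain z where z: "z \<in> S" "\<And>U. openin X U \<Longrightarrow> z \<in> U \<Longrightarrow> infinite {n. a n \<in> U}"
        using cc[of a] by auto
      have "z \<in> F0"
      proof (rule ccontr)
        assume "z \<notin> F0"
        then have "infinite {k. a k \<in> topspace X - F0}"
          using z S clM[OF F0M] by (intro z(2)) auto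
        moreover have "{k. a k \<in> topspace X - F0} = {}"
          using a(1) by (auto simp: H_def)
        ultimately show False by (metis finite.emptyI)
      qed
      then have "z \<in> \<Union>(\<G> n)"
        using Fb[OF \<open>b n\<close>] z(1) by (auto simp: F0_def)
      then obtain U where U: "U \<in> \<G> n" "z \<in> U"
        by auto
      then have inf: "infinite {k. a k \<in> U}"
        by (intro z(2) separating_families_openD[OF \<G>])
      then obtain i where i: "a i \<in> U"
        using not_finite_existsD by auto
      obtain k where k: "k > i" "a k \<in> U"
        using inf unfolding infinite_nat_iff_unbounded by auto
      have "a k \<in> st (a i) n"
        using U(1) i k(2) by (auto simp: st_def)
      with a(2)[OF k(1)] show False by simp
    qed
    then have "\<forall>n. \<exists>E\<in>M. b n \<longrightarrow> E \<inter> H n = {}"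
      using topM by auto
    then obtain E where E: "\<And>n. E n \<in> M" "\<And>n. b n \<Longrightarrow> E n \<inter> H n = {}"
      by metis
    define E0 where "E0 = F0 \<inter> (\<Inter>n. E n)"
    have E0M: "E0 \<in> M"
      using InterM[of "{F0, \<Inter>n. E n}"] F0M INTM[OF E(1)] closedin_subset[OF clM[OF F0M]]
      by (simp add: E0_def inf.absorb2 le_infI1)
    then have "S \<inter> \<Inter>{E0} \<noteq> {}"
      by (intro fipM) auto
    then obtain x where x: "x \<in> S" "x \<in> E0"
      by auto
    have "\<exists>D\<in>M. b n \<longrightarrow> S \<inter> D \<subseteq> st x n" for n
    proof (cases "b n")
      case True
      then have "x \<notin> H n"
        using E(2) x(2) by (auto simp: E0_def)
      then have "topspace X - st x n \<notin> M"
        using x by (auto simp: H_def E0_def)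
      moreover have "closedin X (topspace X - st x n)"
        using st_open by auto
      ultimately obtain D where "D \<in> M" "S \<inter> (topspace X - st x n) \<inter> D = {}"
        using notM by metis
      then show ?thesis
        using S by (intro bexI[of _ D]) auto
    qed (use topM in auto)
    then obtain D where D: "\<And>n. D n \<in> M" "\<And>n. b n \<Longrightarrow> S \<inter> D n \<subseteq> st x n"
      by metis
    have only: "z = x" if z: "z \<in> S" "z \<in> (\<Inter>n. D n)" for z
    proof (rule ccontr)
      assume "z \<noteq> x"
      then obtain n where n: "x \<in> \<Union>(\<G> n)" "\<And>U. U \<in> \<G> n \<Longrightarrow> x \<in> U \<Longrightarrow> z \<notin> U"
        using separating_familiesE[OF \<G>, of x z] x z by metis
      then have "b n"
        using Fnb[of n] x(2) by (auto simp: E0_def F0_def)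
      then have "z \<in> st x n"
        using D(2) z by auto
      then show False
        using n(2) by (auto simp: st_def)
    qed
    have "x \<in> C" if "C \<in> \<U>" for C
    proof -
      have "S \<inter> \<Inter>{C, \<Inter>n. D n} \<noteq> {}"
        using \<U>M[OF that] INTM[OF D(1)] by (intro fipM) auto
      then show ?thesis
        using only by auto
    qed
    with x(1) show ?thesis by auto
  qed
  then show ?thesis
    unfolding compactin_fip using S by auto
qed

section \<open>Dense subspaces with a locally separated remainder\<close>

lemma separating_families_countable_cover:
  assumes \<U>: "countable \<U>" "\<And>U. U \<in> \<U> \<Longrightarrow> openin X U" "S \<subseteq> \<Union>\<U>"
    and sep: "\<And>U. U \<in> \<U> \<Longrightarrow> \<exists>\<G>. separating_families X (S \<inter> U) \<G>"
  shows "\<exists>\<G>. separating_families X S \<G>"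
proof (rule separating_families_countable_Un)
  let ?U = "from_nat_into (insert {} \<U>)"
  have mem: "?U k \<in> insert {} \<U>" for k
    by (rule from_nat_into) simp
  then show "openin X (?U k)" for k
    using \<U>(2) openin_empty by (metis insertE)
  have "range ?U = insert {} \<U>"
    using \<U>(1) by (intro range_from_nat_into) auto
  then show "S \<subseteq> (\<Union>k. ?U k)"
    using \<U>(3) by (simp only:) simp
  have "separating_families X {} (\<lambda>_. {})"
    by (simp add: separating_families_def)
  then show "\<exists>\<G>. separating_families X (S \<inter> ?U k) \<G>" for k
    using mem[of k] sep by (metis insertE inf_bot_right)
qed

lemma compactin_diff_open: "compact_space X \<Longrightarrow> openin X U \<Longrightarrow> compactin X (topspace X - U)"
  by (rule closedin_compact_space) auto

text \<open>
  \<open>F\<close> is the set of points at which the family \<open>V\<close> is not locally finite. Outside a neighbourhood of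
  \<open>F\<close> the family is locally finite on a compact set, so only finitely many members leave it.
\<close>

lemma compact_set_of_accumulation:
  assumes X: "compact_space X" 
    and fin: "\<And>z. z \<in> topspace X - S \<Longrightarrow> \<exists>U. openin X U \<and> z \<in> U \<and> finite {i \<in> I. U \<inter> V i \<noteq> {}}"
  obtains F where "compactin X F" "F \<subseteq> S"
    "\<And>U. openin X U \<Longrightarrow> finite {i \<in> I. U \<inter> V i \<noteq> {}} \<Longrightarrow> F \<inter> U = {}"
    "\<And>W. openin X W \<Longrightarrow> F \<subseteq> W \<Longrightarrow> finite {i \<in> I. V i \<subseteq> topspace X \<and> \<not> V i \<subseteq> W}"
proof -
  define \<U> where "\<U> = {U. openin X U \<and> finite {i \<in> I. U \<inter> V i \<noteq> {}}}"
  define F where "F = topspace X - \<Union>\<U>"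
  have op: "openin X (\<Union>\<U>)"
    unfolding \<U>_def by (intro openin_Union) auto
  show ?thesis
  proof
    show "compactin X F"
      unfolding F_def by (rule compactin_diff_open[OF X op])
    show "F \<subseteq> S"
      using fin by (auto simp: F_def \<U>_def)
    show "F \<inter> U = {}" if "openin X U" "finite {i \<in> I. U \<inter> V i \<noteq> {}}" for U
      using that by (auto simp: F_def \<U>_def)
    fix W assume W: "openin X W" "F \<subseteq> W"
    have "finite {i \<in> I. (topspace X - W) \<inter> V i \<noteq> {}}"
    proof (rule compact_finite_meeting[OF compactin_diff_open[OF X W(1)]])
      fix z assume "z \<in> topspace X - W"
      then have "z \<in> \<Union>\<U>"
        using W(2) by (auto simp: F_def)
      then show "\<exists>U. openin X U \<and> z \<in> U \<and> finite {i \<in> I. U \<inter> V i \<noteq> {}}"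
        by (auto simp: \<U>_def)
    qed
    then show "finite {i \<in> I. V i \<subseteq> topspace X \<and> \<not> V i \<subseteq> W}"
      by (rule rev_finite_subset) auto
  qed
qed

lemma nested_neighbourhoods:
  fixes P :: "nat \<Rightarrow> 'a set"
  assumes X: "regular_space X" and P: "\<And>n. openin X (P n)" "\<And>n. x \<in> P n"
  obtains U :: "nat \<Rightarrow> 'a set" where "\<And>n. openin X (U n)" "\<And>n. x \<in> U n"
    "\<And>n. X closure_of (U (Suc n)) \<subseteq> U n \<inter> P n"
proof -
  have "\<exists>U. \<forall>n. (openin X (U n) \<and> x \<in> U n) \<and> X closure_of (U (Suc n)) \<subseteq> U n \<inter> P n"
  proof (rule dependent_nat_choice)
    show "\<exists>U. openin X U \<and> x \<in> U"
      using P by metis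
    fix U n assume U: "openin X U \<and> x \<in> U"
    then have "openin X (U \<inter> P n)" "x \<in> U \<inter> P n"
      using P by auto
    then show "\<exists>V. (openin X V \<and> x \<in> V) \<and> X closure_of V \<subseteq> U \<inter> P n"
      using regular_shrink[OF X] by metis
  qed
  then obtain U where "\<forall>n. (openin X (U n) \<and> x \<in> U n) \<and> X closure_of (U (Suc n)) \<subseteq> U n \<inter> P n"
    by (rule exE)
  then show ?thesis
    by (intro that[of U]) simp_all
qed

lemma nested_mono:
  fixes U :: "nat \<Rightarrow> 'a set"
  assumes "\<And>n. openin X (U n)" "\<And>n. X closure_of (U (Suc n)) \<subseteq> U n \<inter> P n"
  shows "m \<le> n \<Longrightarrow> U n \<subseteq> U m"
proof (rule lift_Suc_antimono_le[of U])
  fix n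
  have "U (Suc n) \<subseteq> X closure_of (U (Suc n))"
    using assms(1) openin_subset by (metis closure_of_subset)
  then show "U (Suc n) \<subseteq> U n"
    using assms(2)[of n] by auto
qed

lemma Gdelta_point_countable_base:
  fixes P :: "nat \<Rightarrow> 'a set"
  assumes X: "compact_space X" "Hausdorff_space X" and P: "\<And>n. openin X (P n)" "(\<Inter>n. P n) = {x}"
  obtains U :: "nat \<Rightarrow> 'a set" where "\<And>n. openin X (U n)" "\<And>n. x \<in> U n"
    "\<And>W. openin X W \<Longrightarrow> x \<in> W \<Longrightarrow> \<exists>n. U n \<subseteq> W"
proof -
  have xP: "\<And>n. x \<in> P n"
    using P(2) by auto
  obtain U :: "nat \<Rightarrow> 'a set" where U: "\<And>n. openin X (U n)" "\<And>n. x \<in> U n"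
    "\<And>n. X closure_of (U (Suc n)) \<subseteq> U n \<inter> P n"
    using nested_neighbourhoods[of X P x, OF compact_Hausdorff_imp_regular_space[OF X] P(1) xP] by metis
  have U_mono: "m \<le> n \<Longrightarrow> U n \<subseteq> U m" for m n
    using nested_mono[of X U P, OF U(1,3)] .
  have "\<exists>n. U n \<subseteq> W" if W: "openin X W" "x \<in> W" for W
  proof -
    have sub: "\<Inter>(range (\<lambda>n. X closure_of (U n))) \<subseteq> W"
    proof
      fix z assume "z \<in> \<Inter>(range (\<lambda>n. X closure_of (U n)))"
      then have "z \<in> P n" for n
        using U(3)[of n] by auto
      then have "z \<in> {x}"
        unfolding P(2)[symmetric] by simp
      then show "z \<in> W"
        using W(2) by simp
    qed
    have int: "F \<inter> F' \<in> range (\<lambda>n. X closure_of (U n))"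
      if "F \<in> range (\<lambda>n. X closure_of (U n))" "F' \<in> range (\<lambda>n. X closure_of (U n))" for F F'
    proof -
      obtain i j where ij: "F = X closure_of (U i)" "F' = X closure_of (U j)"
        using \<open>F \<in> _\<close> \<open>F' \<in> _\<close> by auto
      have "F \<inter> F' = X closure_of (U (max i j))"
      proof (cases "i \<le> j")
        case True
        then show ?thesis
          using closure_of_mono[OF U_mono[OF True]] by (auto simp: ij max_def)
      next
        case False
        then show ?thesis
          using closure_of_mono[OF U_mono[of j i]] by (auto simp: ij max_def)
      qed
      then show ?thesis by simp
    qed
    obtain F where "F \<in> range (\<lambda>n. X closure_of (U n))" "F \<subseteq> W"
      by (rule compact_Inter_subset_open[OF X(1) _ _ int W(1) sub]) auto
    then show ?thesis
      using closure_of_subset[OF openin_subset[OF U(1)]] by auto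
  qed
  with U(1,2) show ?thesis
    by (rule that)
qed

text \<open>
  The topological situation of the theorem, without the group: \<open>X\<close> and its remainder are dense in the
  compact space \<open>B\<close>, and the remainder has locally a quasi-\<open>G\<^sub>\<delta>\<close>-diagonal.
\<close>

locale locally_separated_remainder =
  fixes B :: "'a topology" and X :: "'a set"
  assumes compact: "compact_space B" and Hausdorff: "Hausdorff_space B"
    and dense: "\<And>U. openin B U \<Longrightarrow> U \<noteq> {} \<Longrightarrow> U \<inter> X \<noteq> {}"
    and codense: "\<And>U. openin B U \<Longrightarrow> U \<noteq> {} \<Longrightarrow> U - X \<noteq> {}"
    and subset: "X \<subseteq> topspace B"
    and nonempty: "topspace B \<noteq> {}"
    and locally_separated: "\<And>y. y \<in> topspace B - X \<Longrightarrow>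
      \<exists>U. openin B U \<and> y \<in> U \<and> (\<exists>\<G>. separating_families B (U - X) \<G>)"
begin

lemma regular: "regular_space B"
  by (rule compact_Hausdorff_imp_regular_space[OF compact Hausdorff])

lemma singleton_pseudocharacter:
  assumes y: "y \<in> topspace B - X"
  obtains P :: "nat \<Rightarrow> 'a set" where "\<And>n. openin B (P n)" "\<And>n. y \<in> P n"
    "\<And>x. x \<in> topspace B - X \<Longrightarrow> x \<noteq> y \<Longrightarrow> \<exists>n. x \<notin> P n"
proof -
  obtain W \<G> where W: "openin B W" "y \<in> W" and \<G>: "separating_families B (W - X) \<G>"
    using locally_separated[OF y] by auto
  have "compactin B {y}" "{y} \<subseteq> W - X" "network_on B {y} {{y}}"
    using y W by (auto simp: network_on_def)
  then obtain P :: "nat \<Rightarrow> 'a set" where P: "\<And>n. openin B (P n)" "\<And>n. {y} \<subseteq> P n"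
    "\<And>x. x \<in> (W - X) - {y} \<Longrightarrow> \<exists>n. x \<notin> P n"
    using compact_countable_pseudocharacter[OF _ _ \<G>, of "{y}" "{{y}}"] by auto
  show ?thesis
  proof
    show "openin B (P n \<inter> W)" "y \<in> P n \<inter> W" for n
      using P W by auto
    show "\<exists>n. x \<notin> P n \<inter> W" if "x \<in> topspace B - X" "x \<noteq> y" for x
      using P(3)[of x] that by (cases "x \<in> W") auto
  qed
qed

text \<open>
  Argue by contradiction. A sequence of nonempty open sets that is locally finite at the points of the
  remainder accumulates only in \<open>X\<close>, and its accumulation set could serve as \<open>F\<close>; so there is no such
  sequence. Hence a \<open>G\<^sub>\<delta>\<close>-point \<open>y\<close> of the remainder has a countable base: if the shrinking
  neighbourhoods \<open>U n\<close> never entered \<open>W\<close>, then the sets \<open>U n\<close> minus a smaller closed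
  neighbourhood of \<open>y\<close> would be such a sequence. If a sequence in the remainder had a cluster
  point \<open>g\<close> in \<open>X\<close>, the bases at its terms would be a countable \<open>\<pi>\<close>-base at \<open>F = {g}\<close>. So the
  remainder is countably compact, and a closed neighbourhood in it of a point \<open>y\<close> is compact by
  \<open>countably_compact_separating_imp_compact\<close>, which contradicts the density of \<open>X\<close>.
\<close>

lemma countable_pi_base_at_compact:
  obtains F and V :: "nat \<Rightarrow> 'a set" where "compactin B F" "F \<subseteq> X"
    "\<And>n. openin B (V n)" "\<And>n. V n \<noteq> {}" "\<And>W. openin B W \<Longrightarrow> F \<subseteq> W \<Longrightarrow> \<exists>n. V n \<subseteq> W"
proof (rule ccontr)
  note pi_base = that
  assume not_thesis: "\<not> thesis"
  have neg: False
    if "compactin B F" "F \<subseteq> X" "\<And>n. openin B (V n)" "\<And>n. V n \<noteq> {}"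
       "\<And>W. openin B W \<Longrightarrow> F \<subseteq> W \<Longrightarrow> \<exists>n. V n \<subseteq> W" for F and V :: "nat \<Rightarrow> 'a set"
    using pi_base[OF that] not_thesis by simp
  \<comment> \<open>Pseudocompactness of the remainder.\<close>
  have not_locally_finite: False
    if V: "\<And>n. openin B (V n)" "\<And>n. V n \<noteq> {}"
      and fin: "\<And>y. y \<in> topspace B - X \<Longrightarrow> \<exists>U. openin B U \<and> y \<in> U \<and> finite {n\<in>UNIV. U \<inter> V n \<noteq> {}}"
    for V :: "nat \<Rightarrow> 'a set"
  proof -
    obtain F where F: "compactin B F" "F \<subseteq> X"
      "\<And>W. openin B W \<Longrightarrow> F \<subseteq> W \<Longrightarrow> finite {n\<in>UNIV. V n \<subseteq> topspace B \<and> \<not> V n \<subseteq> W}"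
      by (rule compact_set_of_accumulation[of B X UNIV V, OF compact fin]) (assumption | rule that)+
    have some: "\<exists>n. V n \<subseteq> W" if W: "openin B W" "F \<subseteq> W" for W
    proof -
      have "{n\<in>UNIV. V n \<subseteq> topspace B \<and> \<not> V n \<subseteq> W} \<noteq> UNIV"
        using F(3)[OF W] infinite_UNIV_nat by metis
      then show ?thesis
        using openin_subset[OF V(1)] by auto
    qed
    show False
      by (rule neg[of F V, OF F(1,2) V some])
  qed
  have base: "\<exists>U::nat \<Rightarrow> 'a set. \<forall>n. openin B (U n) \<and> y \<in> U n \<and>
      (\<forall>W. openin B W \<and> y \<in> W \<longrightarrow> (\<exists>n. U n \<subseteq> W))" if y: "y \<in> topspace B - X" for y
  proof -
    obtain P :: "nat \<Rightarrow> 'a set" where P: "\<And>n. openin B (P n)" "\<And>n. y \<in> P n"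
      "\<And>x. x \<in> topspace B - X \<Longrightarrow> x \<noteq> y \<Longrightarrow> \<exists>n. x \<notin> P n"
      using singleton_pseudocharacter[OF y] by metis
    obtain U :: "nat \<Rightarrow> 'a set" where U: "\<And>n. openin B (U n)" "\<And>n. y \<in> U n"
      "\<And>n. B closure_of (U (Suc n)) \<subseteq> U n \<inter> P n"
      using nested_neighbourhoods[of B P y, OF regular P(1,2)] by metis
    have U_mono: "m \<le> n \<Longrightarrow> U n \<subseteq> U m" for m n
      using nested_mono[of B U P, OF U(1,3)] .
    have "\<exists>n. U n \<subseteq> W" if W: "openin B W" "y \<in> W" for W
    proof (rule ccontr)
      assume nW: "\<nexists>n. U n \<subseteq> W"
      obtain W' where W': "openin B W'" "y \<in> W'" "B closure_of W' \<subseteq> W"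
        using regular_shrink[OF regular W] by metis
      show False
      proof (rule not_locally_finite[of "\<lambda>n. U n - B closure_of W'"])
        show "openin B (U n - B closure_of W')" for n
          using U(1) by (simp add: openin_diff)
        show "U n - B closure_of W' \<noteq> {}" for n
          using nW W'(3) by auto
        fix x assume x: "x \<in> topspace B - X"
        show "\<exists>O'. openin B O' \<and> x \<in> O' \<and> finite {n\<in>UNIV. O' \<inter> (U n - B closure_of W') \<noteq> {}}"
        proof (cases "x = y")
          case True
          have "W' \<inter> (U n - B closure_of W') = {}" for n
            using closure_of_subset[OF openin_subset[OF W'(1)]] by auto
          then show ?thesis
            using True W' by (intro exI[of _ W']) auto
        next
          case False
          then obtain m where "x \<notin> P m"
            using P(3) x by metis
          then have "x \<notin> B closure_of (U (Suc m))"
            using U(3)[of m] by auto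
          moreover have "openin B (topspace B - B closure_of (U (Suc m)))"
            by auto
          moreover have "finite {n\<in>UNIV. (topspace B - B closure_of (U (Suc m))) \<inter> (U n - B closure_of W') \<noteq> {}}"
          proof (rule finite_subset[of _ "{..m}"])
            have "U n \<subseteq> B closure_of (U (Suc m))" if "n > m" for n
              using U_mono[of "Suc m" n] that closure_of_subset[OF openin_subset[OF U(1)[of "Suc m"]]] by auto
            then show "{n\<in>UNIV. (topspace B - B closure_of (U (Suc m))) \<inter> (U n - B closure_of W') \<noteq> {}} \<subseteq> {..m}"
              by (force simp: not_le[symmetric])
          qed simp
          ultimately show ?thesis
            using x by (intro exI[of _ "topspace B - B closure_of (U (Suc m))"]) auto
        qed
      qed
    qed
    with U(1,2) show ?thesis
      by (intro exI[of _ U]) simp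
  qed
  \<comment> \<open>The closure of a countable subset of the remainder stays in the remainder.\<close>
  have closure_seq: "B closure_of (range a) \<inter> X = {}" if a: "range a \<subseteq> topspace B - X" for a :: "nat \<Rightarrow> 'a"
  proof (rule ccontr)
    assume "B closure_of (range a) \<inter> X \<noteq> {}"
    then obtain g where g: "g \<in> B closure_of (range a)" "g \<in> X" by auto
    have "\<forall>k. \<exists>U::nat \<Rightarrow> 'a set. \<forall>n. openin B (U n) \<and> a k \<in> U n \<and>
      (\<forall>W. openin B W \<and> a k \<in> W \<longrightarrow> (\<exists>n. U n \<subseteq> W))"
      using base a by (simp add: image_subset_iff)
    then obtain U :: "nat \<Rightarrow> nat \<Rightarrow> 'a set" where U: "\<And>k n. openin B (U k n)" "\<And>k n. a k \<in> U k n"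
      "\<And>k W. openin B W \<Longrightarrow> a k \<in> W \<Longrightarrow> \<exists>n. U k n \<subseteq> W"
      by metis
    show False
    proof (rule neg[of "{g}" "\<lambda>m. U (fst (prod_decode m)) (snd (prod_decode m))"])
      show "compactin B {g}"
        using g subset by auto
      show "{g} \<subseteq> X" using g by simp
      show "openin B (U (fst (prod_decode m)) (snd (prod_decode m)))" for m
        by (rule U)
      show "U (fst (prod_decode m)) (snd (prod_decode m)) \<noteq> {}" for m
        using U(2) by auto
      fix W assume W: "openin B W" "{g} \<subseteq> W"
      then obtain k where "a k \<in> W"
        using g(1) unfolding in_closure_of by auto
      then obtain n where "U k n \<subseteq> W"
        using U(3) W(1) by metis
      then show "\<exists>m. U (fst (prod_decode m)) (snd (prod_decode m)) \<subseteq> W"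
        by (intro exI[of _ "prod_encode (k, n)"]) simp
    qed
  qed
  obtain y where y: "y \<in> topspace B - X"
    using codense[OF openin_topspace nonempty] by auto
  obtain W \<G> where W: "openin B W" "y \<in> W" and \<G>: "separating_families B (W - X) \<G>"
    using locally_separated[OF y] by auto
  obtain P where P: "openin B P" "y \<in> P" "B closure_of P \<subseteq> W"
    using regular_shrink[OF regular W] by metis
  define S where "S = B closure_of P - X"
  have Stop: "S \<subseteq> topspace B"
    using closure_of_subset_topspace[of B P] by (auto simp: S_def)
  have "compactin B S"
  proof (rule countably_compact_separating_imp_compact[OF Stop])
    show "separating_families B S \<G>"
      by (rule separating_families_subset[OF \<G>]) (use P(3) in \<open>auto simp: S_def\<close>)
    fix a :: "nat \<Rightarrow> 'a" assume a: "range a \<subseteq> S"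
    then obtain z where z: "z \<in> topspace B" "\<And>U. openin B U \<Longrightarrow> z \<in> U \<Longrightarrow> infinite {n. a n \<in> U}"
      using compact_sequence_cluster_point[OF compact, of a] Stop by (metis range_subsetD subsetD)
    have clus: "z \<in> B closure_of A" if "range a \<subseteq> A" for A
      unfolding in_closure_of
    proof (intro conjI allI impI z(1))
      fix U assume "z \<in> U \<and> openin B U"
      then have "infinite {n. a n \<in> U}" using z(2) by simp
      then obtain n where "a n \<in> U" using not_finite_existsD by auto
      then show "\<exists>y. y \<in> A \<and> y \<in> U" using that by auto
    qed
    have "range a \<subseteq> topspace B - X"
      using a Stop by (auto simp: S_def)
    then have "z \<notin> X"
      using closure_seq[of a] clus[of "range a"] by auto
    moreover have "z \<in> B closure_of P"
      using clus[of "B closure_of P"] a by (simp add: S_def subset_Diff_insert image_subset_iff)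
    ultimately have "z \<in> S" by (simp add: S_def)
    with z(2) show "\<exists>z\<in>S. \<forall>U. openin B U \<and> z \<in> U \<longrightarrow> infinite {n. a n \<in> U}"
      by (intro bexI[of _ z]) auto
  qed
  then have "closedin B S"
    using Hausdorff compactin_imp_closedin by metis
  then have op: "openin B (P - S)"
    using P(1) by (simp add: openin_diff)
  have "P \<subseteq> B closure_of P"
    using closure_of_subset[OF openin_subset[OF P(1)]] .
  then have eq: "P - S = P \<inter> X"
    by (auto simp: S_def)
  have "P \<inter> X \<noteq> {}"
    using dense[OF P(1)] P(2) by auto
  then show False
    using codense[OF op] eq by auto
qed

text \<open>
  The set \<open>F\<close> at which the family accumulates is a compact subset of the remainder, hence a \<open>G\<^sub>\<delta>\<close> there.
  Each of the countably many neighbourhoods witnessing this contains all but finitely many members. A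
  member contained in all of them would meet the remainder only inside \<open>F\<close>; but it does meet the
  remainder and, by disjointness, it misses \<open>F\<close>.
\<close>

lemma locally_finite_disjoint_open_family_countable:
  assumes E: "\<And>d. d \<in> D \<Longrightarrow> openin B (E d)" "\<And>d. d \<in> D \<Longrightarrow> E d \<noteq> {}"
      "\<And>d d'. d \<in> D \<Longrightarrow> d' \<in> D \<Longrightarrow> d \<noteq> d' \<Longrightarrow> E d \<inter> E d' = {}"
    and fin: "\<And>x. x \<in> X \<Longrightarrow> \<exists>U. openin B U \<and> x \<in> U \<and> finite {d\<in>D. U \<inter> E d \<noteq> {}}"
  shows "countable D"
proof -
  have fin': "\<exists>U. openin B U \<and> z \<in> U \<and> finite {d\<in>D. U \<inter> E d \<noteq> {}}"
    if "z \<in> topspace B - (topspace B - X)" for z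
    using fin that by auto
  obtain F where F: "compactin B F" "F \<subseteq> topspace B - X"
    "\<And>U. openin B U \<Longrightarrow> finite {d\<in>D. U \<inter> E d \<noteq> {}} \<Longrightarrow> F \<inter> U = {}"
    "\<And>W. openin B W \<Longrightarrow> F \<subseteq> W \<Longrightarrow> finite {d\<in>D. E d \<subseteq> topspace B \<and> \<not> E d \<subseteq> W}"
    by (rule compact_set_of_accumulation[of B "topspace B - X" D E, OF compact fin']) (assumption | rule that)+
  have FE: "F \<inter> E d = {}" if "d \<in> D" for d
  proof (rule F(3)[OF E(1)[OF that]])
    have "{d'\<in>D. E d \<inter> E d' \<noteq> {}} \<subseteq> {d}"
      using E(3) that by auto
    then show "finite {d'\<in>D. E d \<inter> E d' \<noteq> {}}"
      using finite_subset by auto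
  qed
  define \<U> where "\<U> = {U. openin B U \<and> (\<exists>\<G>. separating_families B (U - X) \<G>)}"
  have \<U>_open: "\<forall>U\<in>\<U>. openin B U"
    by (simp add: \<U>_def)
  have F_cover: "F \<subseteq> \<Union>\<U>"
  proof
    fix x assume "x \<in> F"
    then obtain U where "openin B U" "x \<in> U" "\<exists>\<G>. separating_families B (U - X) \<G>"
      using locally_separated[of x] F(2) by auto
    then show "x \<in> \<Union>\<U>"
      unfolding \<U>_def by (intro UnionI[of U]) simp_all
  qed
  with \<U>_open obtain \<H> where \<H>: "finite \<H>" "\<H> \<subseteq> \<U>" "F \<subseteq> \<Union>\<H>"
    using F(1) unfolding compactin_def by metis
  define W where "W = \<Union>\<H>"
  have W: "openin B W"
    using \<H>(2) unfolding W_def \<U>_def by (intro openin_Union) auto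
  have "\<exists>\<G>. separating_families B (W - X) \<G>"
  proof (rule separating_families_countable_cover)
    show "countable \<H>" using \<H>(1) by (rule countable_finite)
    show "openin B U" if "U \<in> \<H>" for U
      using that \<H>(2) by (auto simp: \<U>_def)
    show "W - X \<subseteq> \<Union>\<H>" by (auto simp: W_def)
    show "\<exists>\<G>. separating_families B ((W - X) \<inter> U) \<G>" if "U \<in> \<H>" for U
    proof -
      have "U \<in> \<U>"
        using that \<H>(2) by auto
      then obtain \<G> where "separating_families B (U - X) \<G>"
        by (auto simp: \<U>_def)
      then have "separating_families B ((W - X) \<inter> U) \<G>"
        by (rule separating_families_subset) auto
      then show ?thesis by (intro exI[of _ \<G>])
    qed
  qed
  then obtain \<G> where \<G>: "separating_families B (W - X) \<G>"
    by auto
  have FW: "F \<subseteq> W - X"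
    using \<H>(3) F(2) by (auto simp: W_def)
  have "Sigma_cover B F {F}"
    using compactin_imp_closedin[OF Hausdorff F(1)] by (auto simp: Sigma_cover_def)
  then obtain \<N> where "countable \<N>" "network_on B F \<N>"
    using separating_families_network[OF compact _ compactin_subset_topspace[OF F(1)] separating_families_subset[OF \<G> FW]]
    by metis
  then obtain P :: "nat \<Rightarrow> 'a set" where P: "\<And>n. openin B (P n)" "\<And>n. F \<subseteq> P n"
    "\<And>x. x \<in> (W - X) - F \<Longrightarrow> \<exists>n. x \<notin> P n"
    using compact_countable_pseudocharacter[OF F(1) FW \<G>] by metis
  have "finite {d\<in>D. E d \<subseteq> topspace B \<and> \<not> E d \<subseteq> P n \<inter> W}" for n
    by (rule F(4)) (use P W FW in auto)
  then have "countable (\<Union>n. {d\<in>D. E d \<subseteq> topspace B \<and> \<not> E d \<subseteq> P n \<inter> W})"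
    by (intro countable_UN) (auto intro: countable_finite)
  moreover have "D \<subseteq> (\<Union>n. {d\<in>D. E d \<subseteq> topspace B \<and> \<not> E d \<subseteq> P n \<inter> W})"
  proof
    fix d assume d: "d \<in> D"
    obtain y where y: "y \<in> E d" "y \<notin> X"
      using codense[OF E(1,2)] d by auto
    then have "y \<notin> F"
      using FE[OF d] by auto
    have "\<exists>n. \<not> E d \<subseteq> P n \<inter> W"
    proof (cases "y \<in> W")
      case True
      then show ?thesis using P(3)[of y] y \<open>y \<notin> F\<close> by auto
    qed (use y in auto)
    then show "d \<in> (\<Union>n. {d\<in>D. E d \<subseteq> topspace B \<and> \<not> E d \<subseteq> P n \<inter> W})"
      using d openin_subset[OF E(1)[OF d]] by auto
  qed
  ultimately show ?thesis
    by (rule countable_subset[rotated])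
qed

text \<open>
  The complements of the sets in \<open>\<E>\<close> cut the remainder out of \<open>B\<close>, so the remainder is Lindelof, its
  local quasi-\<open>G\<^sub>\<delta>\<close>-diagonals combine to one, and it has a countable network. The
  complements of the closures show moreover that each point of the remainder lies in a \<open>G\<^sub>\<delta>\<close>-set of \<open>B\<close>
  inside the remainder; so it is a \<open>G\<^sub>\<delta>\<close>-point of \<open>B\<close> and has a countable base there. The
  bases at a countable dense set of the remainder form a \<open>\<pi>\<close>-base, as the remainder is dense.
\<close>

lemma network_and_pi_base_of_separating_open_family:
  assumes \<E>: "countable \<E>" "\<And>E. E \<in> \<E> \<Longrightarrow> openin B E"
    and sep: "\<And>g y. g \<in> X \<Longrightarrow> y \<in> topspace B - X \<Longrightarrow> \<exists>E\<in>\<E>. g \<in> E \<and> y \<notin> B closure_of E"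
  obtains \<N> \<V> where "countable \<N>" "network_on B (topspace B - X) \<N>"
    "countable \<V>" "\<And>V. V \<in> \<V> \<Longrightarrow> openin B V \<and> V \<noteq> {}"
    "\<And>W. openin B W \<Longrightarrow> W \<noteq> {} \<Longrightarrow> \<exists>V\<in>\<V>. V \<subseteq> W"
proof -
  let ?Y = "topspace B - X"
  define \<C> where "\<C> = (\<lambda>E. topspace B - E) ` \<E>"
  have "topspace B \<inter> \<Inter>{F\<in>\<C>. y \<in> F} \<subseteq> ?Y" if y: "y \<in> ?Y" for y
  proof
    fix z assume z: "z \<in> topspace B \<inter> \<Inter>{F\<in>\<C>. y \<in> F}"
    have "z \<notin> X"
    proof
      assume "z \<in> X"
      then obtain E where E: "E \<in> \<E>" "z \<in> E" "y \<notin> B closure_of E"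
        using sep y by metis
      then have "y \<notin> E"
        using closure_of_subset[OF openin_subset[OF \<E>(2)[OF E(1)]]] by auto
      then have "topspace B - E \<in> {F\<in>\<C>. y \<in> F}"
        using y E(1) by (auto simp: \<C>_def)
      then show False
        using z E(2) by auto
    qed
    with z show "z \<in> ?Y" by simp
  qed
  then have \<C>: "Sigma_cover B ?Y \<C>"
    using \<E> by (auto simp: Sigma_cover_def \<C>_def)
  define \<U> where "\<U> = {U. openin B U \<and> (\<exists>\<G>. separating_families B (U - X) \<G>)}"
  have "topspace B \<inter> ?Y \<subseteq> \<Union>\<U>"
  proof
    fix x assume "x \<in> topspace B \<inter> ?Y"
    then obtain U where "openin B U" "x \<in> U" "\<exists>\<G>. separating_families B (U - X) \<G>"
      using locally_separated[of x] by auto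
    then show "x \<in> \<Union>\<U>"
      unfolding \<U>_def by (intro UnionI[of U]) simp_all
  qed
  then obtain \<V> where \<V>: "countable \<V>" "\<V> \<subseteq> \<U>" "topspace B \<inter> ?Y \<subseteq> \<Union>\<V>"
    using Sigma_cover_Lindelof_closed[OF compact \<C> closedin_topspace, of \<U>] unfolding \<U>_def by auto
  have "\<exists>\<G>. separating_families B ?Y \<G>"
  proof (rule separating_families_countable_cover[OF \<V>(1)])
    show "openin B U" if "U \<in> \<V>" for U
      using that \<V>(2) by (auto simp: \<U>_def)
    show "?Y \<subseteq> \<Union>\<V>"
      using \<V>(3) by auto
    show "\<exists>\<G>. separating_families B (?Y \<inter> U) \<G>" if "U \<in> \<V>" for U
    proof -
      have "U \<in> \<U>"
        using that \<V>(2) by auto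
      then obtain \<G> where "separating_families B (U - X) \<G>"
        by (auto simp: \<U>_def)
      then have "separating_families B (?Y \<inter> U) \<G>"
        by (rule separating_families_subset) auto
      then show ?thesis by (intro exI[of _ \<G>])
    qed
  qed
  then obtain \<G> where \<G>: "separating_families B ?Y \<G>"
    by auto
  obtain \<N> where \<N>: "countable \<N>" "network_on B ?Y \<N>"
    by (rule separating_families_network[OF compact \<C> _ \<G>]) auto
  obtain D where D: "countable D" "D \<subseteq> ?Y" "\<And>U. openin B U \<Longrightarrow> U \<inter> ?Y \<noteq> {} \<Longrightarrow> U \<inter> D \<noteq> {}"
    by (rule network_on_dense_subset[OF \<N>]) (assumption | rule that)+
  have base: "\<exists>U::nat \<Rightarrow> 'a set. (\<forall>n. openin B (U n) \<and> y \<in> U n) \<and> (\<forall>W. openin B W \<and> y \<in> W \<longrightarrow> (\<exists>n. U n \<subseteq> W))"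
    if y: "y \<in> ?Y" for y
  proof -
    obtain P :: "nat \<Rightarrow> 'a set" where P: "\<And>n. openin B (P n)" "\<And>n. y \<in> P n"
      "\<And>x. x \<in> ?Y \<Longrightarrow> x \<noteq> y \<Longrightarrow> \<exists>n. x \<notin> P n"
      using singleton_pseudocharacter[OF y] by metis
    define \<Q> where "\<Q> = insert (topspace B) (range P \<union> (\<lambda>E. topspace B - B closure_of E) ` {E\<in>\<E>. y \<notin> B closure_of E})"
    have \<Q>: "countable \<Q>" "\<Q> \<noteq> {}"
      using \<E>(1) by (auto simp: \<Q>_def)
    have \<Q>_open: "openin B Q \<and> y \<in> Q" if "Q \<in> \<Q>" for Q
      using that P(1,2) y by (auto simp: \<Q>_def)
    have "\<Inter>\<Q> \<subseteq> {y}"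
    proof
      fix x assume x: "x \<in> \<Inter>\<Q>"
      then have "x \<in> topspace B" "\<And>n. x \<in> P n"
        by (auto simp: \<Q>_def)
      moreover have "x \<notin> X"
      proof
        assume "x \<in> X"
        then obtain E where E: "E \<in> \<E>" "x \<in> E" "y \<notin> B closure_of E"
          using sep y by metis
        then have "x \<in> topspace B - B closure_of E"
          using x by (auto simp: \<Q>_def)
        then show False
          using E(2) closure_of_subset[OF openin_subset[OF \<E>(2)[OF E(1)]]] by auto
      qed
      ultimately show "x \<in> {y}"
        using P(3)[of x] by auto
    qed
    then have "\<Inter>\<Q> = {y}"
      using \<Q>_open by auto
    then have "(\<Inter>n. from_nat_into \<Q> n) = {y}"
      using range_from_nat_into[OF \<Q>(2,1)] by simp
    moreover have "openin B (from_nat_into \<Q> n)" for n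
      using from_nat_into[OF \<Q>(2)] \<Q>_open by metis
    ultimately obtain U :: "nat \<Rightarrow> 'a set" where "\<And>n. openin B (U n)" "\<And>n. y \<in> U n"
      "\<And>W. openin B W \<Longrightarrow> y \<in> W \<Longrightarrow> \<exists>n. U n \<subseteq> W"
      using Gdelta_point_countable_base[OF compact Hausdorff, of "from_nat_into \<Q>" y] by metis
    then show ?thesis
      by (intro exI[of _ U]) simp
  qed
  have "\<forall>y\<in>?Y. \<exists>U::nat \<Rightarrow> 'a set. (\<forall>n. openin B (U n) \<and> y \<in> U n) \<and> (\<forall>W. openin B W \<and> y \<in> W \<longrightarrow> (\<exists>n. U n \<subseteq> W))"
    using base by simp
  then obtain U :: "'a \<Rightarrow> nat \<Rightarrow> 'a set" where
    "\<forall>y\<in>?Y. (\<forall>n. openin B (U y n) \<and> y \<in> U y n) \<and> (\<forall>W. openin B W \<and> y \<in> W \<longrightarrow> (\<exists>n. U y n \<subseteq> W))"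
    unfolding bchoice_iff by (elim exE)
  then have U: "\<And>y n. y \<in> ?Y \<Longrightarrow> openin B (U y n)" "\<And>y n. y \<in> ?Y \<Longrightarrow> y \<in> U y n"
    "\<And>y W. y \<in> ?Y \<Longrightarrow> openin B W \<Longrightarrow> y \<in> W \<Longrightarrow> \<exists>n. U y n \<subseteq> W"
    by simp_all
  show ?thesis
  proof (rule that[OF \<N>])
    show "countable (\<Union>y\<in>D. range (U y))"
      using D(1) by auto
    show "openin B V \<and> V \<noteq> {}" if "V \<in> (\<Union>y\<in>D. range (U y))" for V
    proof -
      obtain y n where "y \<in> D" "V = U y n"
        using \<open>V \<in> _\<close> by auto
      then show ?thesis
        using U(1)[of y n] U(2)[of y n] D(2) by auto
    qed
    fix W assume W: "openin B W" "W \<noteq> {}"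
    then have "W \<inter> ?Y \<noteq> {}"
      using codense[OF W] openin_subset[OF W(1)] by auto
    then obtain y where y: "y \<in> D" "y \<in> W"
      using D(3)[OF W(1)] by auto
    then obtain n where "U y n \<subseteq> W"
      using U(3)[of y W] D(2) W(1) by auto
    with y show "\<exists>V\<in>(\<Union>y\<in>D. range (U y)). V \<subseteq> W"
      by (intro bexI[of _ "U y n"]) auto
  qed
qed

end

section \<open>Topological groups\<close>

context topological_group begin

lemma one_in_topspace: "\<one> \<in> topspace T"
  by (simp add: topspace_eq)

lemma continuous_map_mult:
  assumes "continuous_map X T f" "continuous_map X T g"
  shows "continuous_map X T (\<lambda>x. f x \<otimes> g x)"
proof -
  have "continuous_map X (prod_topology T T) (\<lambda>x. (f x, g x))"
    using assms by (simp add: continuous_map_pairwise o_def)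
  from continuous_map_compose[OF this continuous_mult] show ?thesis
    by (simp add: o_def)
qed

lemma continuous_map_inv:
  assumes "continuous_map X T f"
  shows "continuous_map X T (\<lambda>x. inv (f x))"
  using continuous_map_compose[OF assms continuous_inv] by (simp add: o_def)

lemma continuous_map_left_translation: "g \<in> carrier G \<Longrightarrow> continuous_map T T (\<lambda>x. g \<otimes> x)"
  by (rule continuous_map_mult) (simp_all add: topspace_eq continuous_map_const)

lemma openin_left_translation:
  assumes "g \<in> carrier G" "openin T W"
  shows "openin T {x \<in> carrier G. g \<otimes> x \<in> W}"
  using openin_continuous_map_preimage[OF continuous_map_left_translation[OF assms(1)] assms(2)]
  by (simp add: topspace_eq)

lemma openin_carrier: "openin T W \<Longrightarrow> x \<in> W \<Longrightarrow> x \<in> carrier G"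
  using openin_subset topspace_eq by auto

lemma inv_mult_cancel: "a \<in> carrier G \<Longrightarrow> b \<in> carrier G \<Longrightarrow> inv a \<otimes> (a \<otimes> b) = b"
  by (simp add: m_assoc[symmetric])

lemma mult_inv_cancel: "a \<in> carrier G \<Longrightarrow> b \<in> carrier G \<Longrightarrow> a \<otimes> (inv a \<otimes> b) = b"
  by (simp add: m_assoc[symmetric])

lemma inv_inv_mult: "a \<in> carrier G \<Longrightarrow> b \<in> carrier G \<Longrightarrow> inv (inv a \<otimes> b) = inv b \<otimes> a"
  by (simp add: inv_mult_group)

lemma inv_mult_trans:
  "a \<in> carrier G \<Longrightarrow> b \<in> carrier G \<Longrightarrow> c \<in> carrier G \<Longrightarrow> (inv a \<otimes> b) \<otimes> (inv b \<otimes> c) = inv a \<otimes> c"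
  by (simp add: m_assoc mult_inv_cancel)

lemma symmetric_square_root:
  assumes U: "openin T U" "\<one> \<in> U"
  obtains V where "openin T V" "\<one> \<in> V" "\<And>x. x \<in> V \<Longrightarrow> inv x \<in> V"
    "\<And>x y. x \<in> V \<Longrightarrow> y \<in> V \<Longrightarrow> x \<otimes> y \<in> U" "V \<subseteq> U"
proof -
  define m where "m p = fst p \<otimes> snd p" for p
  have m: "continuous_map (prod_topology T T) T m"
    unfolding m_def by (intro continuous_map_mult continuous_map_fst continuous_map_snd)
  define R where "R = {p \<in> topspace (prod_topology T T). m p \<in> U}"
  have "openin (prod_topology T T) R"
    unfolding R_def by (rule openin_continuous_map_preimage[OF m U(1)])
  moreover have "(\<one>, \<one>) \<in> R"
    using U(2) by (simp add: R_def m_def topspace_eq)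
  ultimately have "\<exists>A B. openin T A \<and> openin T B \<and> \<one> \<in> A \<and> \<one> \<in> B \<and> A \<times> B \<subseteq> R"
    unfolding openin_prod_topology_alt by simp
  then obtain A B where AB: "openin T A" "openin T B" "\<one> \<in> A" "\<one> \<in> B" "A \<times> B \<subseteq> R"
    by (elim exE conjE)
  define V0 where "V0 = A \<inter> B"
  define V where "V = V0 \<inter> {x \<in> topspace T. inv x \<in> V0}"
  have V0: "openin T V0" "\<one> \<in> V0"
    using AB by (auto simp: V0_def)
  have prod: "x \<otimes> y \<in> U" if "x \<in> V" "y \<in> V" for x y
  proof -
    have "(x, y) \<in> A \<times> B"
      using that by (simp add: V_def V0_def)
    then have "(x, y) \<in> R"
      using AB(5) by (rule rev_subsetD)
    then show ?thesis
      by (simp add: R_def m_def)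
  qed
  have one: "\<one> \<in> V"
    using V0 one_in_topspace by (simp add: V_def)
  show ?thesis
  proof
    show "openin T V"
      unfolding V_def using V0(1) openin_continuous_map_preimage[OF continuous_inv V0(1)] by (rule openin_Int)
    show "\<one> \<in> V" by (rule one)
    show "inv x \<in> V" if "x \<in> V" for x
      using that by (auto simp: V_def topspace_eq)
    show "x \<otimes> y \<in> U" if "x \<in> V" "y \<in> V" for x y
      using that by (rule prod)
    show "V \<subseteq> U"
    proof
      fix x assume x: "x \<in> V"
      then have "x \<in> carrier G" by (simp add: V_def topspace_eq)
      then show "x \<in> U"
        using prod[OF x one] by simp
    qed
  qed
qed

lemma locally_compact_of_open_in_compact:
  assumes V: "openin T V" "V \<noteq> {}" and K: "compactin T K" "V \<subseteq> K"
  shows "locally_compact_space T"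
  unfolding locally_compact_space_def
proof
  fix x assume "x \<in> topspace T"
  then have x: "x \<in> carrier G" by (simp add: topspace_eq)
  obtain u where u: "u \<in> V" "u \<in> carrier G"
    using V openin_carrier by auto
  define N where "N = {z \<in> carrier G. (u \<otimes> inv x) \<otimes> z \<in> V}"
  have "openin T N"
    unfolding N_def by (rule openin_left_translation) (use x u V in auto)
  moreover have "compactin T ((\<lambda>z. (x \<otimes> inv u) \<otimes> z) ` K)"
    by (rule image_compactin[OF K(1) continuous_map_left_translation]) (use x u in auto)
  moreover have "x \<in> N"
    using x u by (simp add: N_def m_assoc)
  moreover have "N \<subseteq> (\<lambda>z. (x \<otimes> inv u) \<otimes> z) ` K"
  proof
    fix z assume z: "z \<in> N"
    then have "(u \<otimes> inv x) \<otimes> z \<in> K" "z = (x \<otimes> inv u) \<otimes> ((u \<otimes> inv x) \<otimes> z)"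
      using K(2) x u by (auto simp: N_def m_assoc inv_mult_cancel mult_inv_cancel)
    then show "z \<in> (\<lambda>z. (x \<otimes> inv u) \<otimes> z) ` K" by (rule rev_image_eqI)
  qed
  ultimately show "\<exists>U K. openin T U \<and> compactin T K \<and> x \<in> U \<and> U \<subseteq> K"
    by (intro exI[of _ N] exI[of _ "(\<lambda>z. (x \<otimes> inv u) \<otimes> z) ` K"]) simp
qed

lemma open_difference_neighbourhood:
  assumes "openin T V" "v \<in> V"
  shows "openin T {z \<in> carrier G. v \<otimes> z \<in> V}" "\<one> \<in> {z \<in> carrier G. v \<otimes> z \<in> V}"
  using assms openin_carrier[OF assms] by (auto intro: openin_left_translation)

text \<open>
  Let \<open>K\<close> be the compact set of all \<open>x\<inverse>y\<close> with \<open>x, y \<in> F\<close>. If \<open>V n\<close> is close to \<open>F\<close>, then its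
  differences are close to \<open>K\<close>, and they contain a neighbourhood \<open>N n\<close> of the unit. The \<open>W n\<close> are
  chosen decreasing with \<open>W (Suc n) \<subseteq> N n\<close>, so every neighbourhood of \<open>K\<close> contains almost all of them,
  and by compactness the same is true for the part \<open>H\<close> of \<open>K\<close> in the closures of all \<open>W n\<close>.
\<close>

lemma compact_countable_character:
  fixes V :: "nat \<Rightarrow> 'a set"
  assumes F: "compactin T F" and V: "\<And>n. openin T (V n)" "\<And>n. V n \<noteq> {}"
    and pi: "\<And>W. openin T W \<Longrightarrow> F \<subseteq> W \<Longrightarrow> \<exists>n. V n \<subseteq> W"
  obtains H and W :: "nat \<Rightarrow> 'a set" where "compactin T H"
    "\<And>n. openin T (W n)" "\<And>n. \<one> \<in> W n" "\<And>n x. x \<in> W n \<Longrightarrow> inv x \<in> W n"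
    "\<And>n x y. x \<in> W (Suc n) \<Longrightarrow> y \<in> W (Suc n) \<Longrightarrow> x \<otimes> y \<in> W n"
    "\<And>U. openin T U \<Longrightarrow> H \<subseteq> U \<Longrightarrow> \<exists>n. W n \<subseteq> U"
proof -
  define d where "d p = inv (fst p) \<otimes> snd p" for p
  have d_cont: "continuous_map (prod_topology T T) T d"
    unfolding d_def by (intro continuous_map_mult continuous_map_inv continuous_map_fst continuous_map_snd)
  define K where "K = d ` (F \<times> F)"
  have K: "compactin T K"
    unfolding K_def by (rule image_compactin[OF _ d_cont]) (simp add: compactin_Times F)
  have "\<forall>n. \<exists>v. v \<in> V n"
    using V(2) by auto
  then obtain v where v: "\<And>n. v n \<in> V n"
    by metis
  define N where "N n = {z \<in> carrier G. v n \<otimes> z \<in> V n}" for n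
  have N: "openin T (N n)" "\<one> \<in> N n" for n
    unfolding N_def by (rule open_difference_neighbourhood[OF V(1) v])+
  have N_small: "\<exists>n. N n \<subseteq> U" if U: "openin T U" "K \<subseteq> U" for U
  proof -
    have "openin (prod_topology T T) {p \<in> topspace (prod_topology T T). d p \<in> U}"
      by (rule openin_continuous_map_preimage[OF d_cont U(1)])
    moreover have "F \<times> F \<subseteq> {p \<in> topspace (prod_topology T T). d p \<in> U}"
      using U(2) compactin_subset_topspace[OF F] by (auto simp: K_def)
    ultimately obtain A B where AB: "openin T A" "openin T B" "F \<subseteq> A" "F \<subseteq> B"
      "A \<times> B \<subseteq> {p \<in> topspace (prod_topology T T). d p \<in> U}"
      by (rule Wallace_theorem_prod_topology[OF F F])
    obtain n where n: "V n \<subseteq> A \<inter> B"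
      using pi[of "A \<inter> B"] AB by auto
    have "N n \<subseteq> U"
    proof
      fix z assume z: "z \<in> N n"
      then have "(v n, v n \<otimes> z) \<in> A \<times> B"
        using v[of n] n by (auto simp: N_def)
      then have "d (v n, v n \<otimes> z) \<in> U"
        using AB(5) by auto
      then show "z \<in> U"
        using z openin_carrier[OF V(1) v] by (simp add: N_def d_def inv_mult_cancel)
    qed
    then show ?thesis by (rule exI)
  qed
  have "\<exists>W. \<forall>n. (openin T (W n) \<and> \<one> \<in> W n \<and> (\<forall>x\<in>W n. inv x \<in> W n)) \<and>
     (W (Suc n) \<subseteq> W n \<inter> N n \<and> (\<forall>x\<in>W (Suc n). \<forall>y\<in>W (Suc n). x \<otimes> y \<in> W n \<inter> N n))"
  proof (rule dependent_nat_choice)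
    have "openin T (topspace T) \<and> \<one> \<in> topspace T \<and> (\<forall>x\<in>topspace T. inv x \<in> topspace T)"
      by (simp add: topspace_eq[symmetric] one_in_topspace) (simp add: topspace_eq)
    then show "\<exists>W. openin T W \<and> \<one> \<in> W \<and> (\<forall>x\<in>W. inv x \<in> W)"
      by (rule exI)
    fix W n assume W: "openin T W \<and> \<one> \<in> W \<and> (\<forall>x\<in>W. inv x \<in> W)"
    have "openin T (W \<inter> N n)" "\<one> \<in> W \<inter> N n"
      using W N by auto
    then obtain W' where "openin T W'" "\<one> \<in> W'" "\<And>x. x \<in> W' \<Longrightarrow> inv x \<in> W'"
      "\<And>x y. x \<in> W' \<Longrightarrow> y \<in> W' \<Longrightarrow> x \<otimes> y \<in> W \<inter> N n" "W' \<subseteq> W \<inter> N n"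
      by (rule symmetric_square_root) (assumption | rule that)+
    then show "\<exists>W'. (openin T W' \<and> \<one> \<in> W' \<and> (\<forall>x\<in>W'. inv x \<in> W')) \<and>
      (W' \<subseteq> W \<inter> N n \<and> (\<forall>x\<in>W'. \<forall>y\<in>W'. x \<otimes> y \<in> W \<inter> N n))"
      by (intro exI[of _ W']) simp
  qed
  then obtain W :: "nat \<Rightarrow> 'a set" where W: "\<forall>n. (openin T (W n) \<and> \<one> \<in> W n \<and> (\<forall>x\<in>W n. inv x \<in> W n)) \<and>
     (W (Suc n) \<subseteq> W n \<inter> N n \<and> (\<forall>x\<in>W (Suc n). \<forall>y\<in>W (Suc n). x \<otimes> y \<in> W n \<inter> N n))"
    by (rule exE)
  have W_mono: "m \<le> n \<Longrightarrow> W n \<subseteq> W m" for m n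
    by (rule lift_Suc_antimono_le[of W]) (use W in auto)
  define H where "H = K \<inter> (\<Inter>n. T closure_of (W n))"
  have "closedin T (\<Inter>n. T closure_of (W n))"
    by (intro closedin_INT) auto
  then have H: "compactin T H"
    unfolding H_def by (rule compact_Int_closedin[OF K])
  have "\<exists>n. W n \<subseteq> U" if U: "openin T U" "H \<subseteq> U" for U
  proof -
    \<comment> \<open>The complements of the closures exhaust \<open>K\<close> up to \<open>U\<close>, so one of them suffices.\<close>
    define Z where "Z n = U \<union> (topspace T - T closure_of (W n))" for n
    have Z_open: "openin T (Z n)" for n
      unfolding Z_def using U(1) by (intro openin_Un) auto
    have Z_mono: "Z m \<subseteq> Z n" if "m \<le> n" for m n
      using closure_of_mono[OF W_mono[OF that]] by (auto simp: Z_def)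
    have "K \<subseteq> \<Union>(range Z)"
    proof
      fix x assume x: "x \<in> K"
      then have "x \<in> topspace T"
        using compactin_subset_topspace[OF K] by auto
      with x U(2) show "x \<in> \<Union>(range Z)"
        by (cases "x \<in> H") (auto simp: Z_def H_def)
    qed
    moreover have "\<forall>S\<in>range Z. openin T S"
      using Z_open by auto
    ultimately obtain \<F> where \<F>: "finite \<F>" "\<F> \<subseteq> range Z" "K \<subseteq> \<Union>\<F>"
      using K unfolding compactin_def by metis
    obtain M where M: "finite M" "\<F> = Z ` M"
      using \<F>(1,2) by (metis finite_subset_image)
    define m where "m = Max (insert 0 M)"
    have "Z n \<subseteq> Z m" if "n \<in> M" for n
      by (rule Z_mono) (use M(1) that in \<open>simp add: m_def\<close>)
    then have "\<Union>(Z ` M) \<subseteq> Z m"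
      by (rule UN_least)
    with \<F>(3) have "K \<subseteq> Z m"
      unfolding M(2) by (rule subset_trans)
    from N_small[OF Z_open this] obtain n where n: "N n \<subseteq> Z m"
      by (rule exE)
    define k where "k = max (Suc n) m"
    have "W k \<subseteq> W (Suc n)" "W k \<subseteq> W m"
      by (auto intro!: W_mono simp: k_def)
    moreover have "W (Suc n) \<subseteq> N n"
      using W by simp
    moreover have "W m \<subseteq> T closure_of (W m)"
      using W openin_subset[of T "W m"] by (simp add: closure_of_subset)
    ultimately have "W k \<subseteq> Z m" "W k \<subseteq> T closure_of (W m)"
      using n by (metis order_trans)+
    then have "W k \<subseteq> U"
      by (auto simp: Z_def)
    then show ?thesis by (rule exI)
  qed
  with H W show ?thesis
    by (intro that[of H W]) simp_all
qed

text \<open>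
  Take a maximal set \<open>D\<close> of elements no two of which are \<open>V\<close>-close for a symmetric \<open>V \<subseteq> W\<close>. Its
  \<open>V\<close>-translates cover the group. The translates by a fourth root \<open>V2\<close> of \<open>V\<close> form a discrete family
  in the group, and their extensions to \<open>B\<close> are disjoint because the group is dense. Hence \<open>D\<close> is countable by
  \<open>locally_finite_disjoint_open_family_countable\<close>.
\<close>

lemma narrow_covering:
  assumes T: "T = subtopology B (carrier G)" and "locally_separated_remainder B (carrier G)"
    and W: "openin T W" "\<one> \<in> W"
  obtains D where "countable D" "D \<subseteq> carrier G" "\<And>g. g \<in> carrier G \<Longrightarrow> \<exists>d\<in>D. inv d \<otimes> g \<in> W"
proof -
  interpret B: locally_separated_remainder B "carrier G" by fact
  obtain V where V: "openin T V" "\<one> \<in> V" "\<And>x. x \<in> V \<Longrightarrow> inv x \<in> V" "V \<subseteq> W"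
    using W by (rule symmetric_square_root) (assumption | rule that)+
  obtain V1 where V1: "openin T V1" "\<one> \<in> V1" "\<And>x. x \<in> V1 \<Longrightarrow> inv x \<in> V1"
      "\<And>x y. x \<in> V1 \<Longrightarrow> y \<in> V1 \<Longrightarrow> x \<otimes> y \<in> V" "V1 \<subseteq> V"
    using V(1,2) by (rule symmetric_square_root) (assumption | rule that)+
  obtain V2 where V2: "openin T V2" "\<one> \<in> V2" "\<And>x. x \<in> V2 \<Longrightarrow> inv x \<in> V2"
      "\<And>x y. x \<in> V2 \<Longrightarrow> y \<in> V2 \<Longrightarrow> x \<otimes> y \<in> V1"
    using V1(1,2) by (rule symmetric_square_root) (assumption | rule that)+
  define \<AA> where "\<AA> = {D. D \<subseteq> carrier G \<and> (\<forall>d\<in>D. \<forall>d'\<in>D. d \<noteq> d' \<longrightarrow> inv d \<otimes> d' \<notin> V)}"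
  have "\<exists>D\<in>\<AA>. \<forall>D'\<in>\<AA>. D \<subseteq> D' \<longrightarrow> D' = D"
  proof (rule subset_Zorn_nonempty)
    have "{} \<in> \<AA>" by (simp add: \<AA>_def)
    then show "\<AA> \<noteq> {}" by auto
    fix \<C> assume \<C>: "\<C> \<noteq> {}" "subset.chain \<AA> \<C>"
    have sub: "D \<in> \<AA>" if "D \<in> \<C>" for D
      using \<C>(2) that unfolding subset.chain_def by auto
    have "inv d \<otimes> d' \<notin> V" if d: "d \<in> \<Union>\<C>" "d' \<in> \<Union>\<C>" "d \<noteq> d'" for d d'
    proof -
      have "finite {d, d'}" "{d, d'} \<subseteq> \<Union>\<C>"
        using d by auto
      then obtain D where "D \<in> \<C>" "{d, d'} \<subseteq> D"
        using finite_subset_Union_chain[OF _ _ \<C>] by metis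
      then show ?thesis
        using sub[of D] d(3) by (simp add: \<AA>_def)
    qed
    moreover have "\<Union>\<C> \<subseteq> carrier G"
      using sub unfolding \<AA>_def by (intro Union_least) simp
    ultimately show "\<Union>\<C> \<in> \<AA>"
      unfolding \<AA>_def by simp
  qed
  then obtain D where D: "D \<in> \<AA>" "\<And>D'. D' \<in> \<AA> \<Longrightarrow> D \<subseteq> D' \<Longrightarrow> D' = D"
    by metis
  have DG: "d \<in> carrier G" if "d \<in> D" for d
    using D(1) that by (auto simp: \<AA>_def)
  have Dsep: "inv d \<otimes> d' \<notin> V" if "d \<in> D" "d' \<in> D" "d \<noteq> d'" for d d'
    using D(1) that by (auto simp: \<AA>_def)
  have cover: "\<exists>d\<in>D. inv d \<otimes> g \<in> V" if g: "g \<in> carrier G" for g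
  proof (rule ccontr)
    assume neg: "\<not> (\<exists>d\<in>D. inv d \<otimes> g \<in> V)"
    have "inv g \<otimes> d \<notin> V" if "d \<in> D" for d
    proof
      assume "inv g \<otimes> d \<in> V"
      then have "inv d \<otimes> g \<in> V"
        using V(3) inv_inv_mult[OF g DG[OF that]] by metis
      then show False using neg that by auto
    qed
    then have "insert g D \<in> \<AA>"
      using D(1) neg g by (auto simp: \<AA>_def)
    then have "g \<in> D"
      using D(2)[of "insert g D"] by auto
    then show False
      using neg g V(2) by (metis l_inv)
  qed
  have "\<forall>d. \<exists>E. openin B E \<and> (d \<in> carrier G \<longrightarrow> {x \<in> carrier G. inv d \<otimes> x \<in> V2} = E \<inter> carrier G)"
  proof
    fix d
    show "\<exists>E. openin B E \<and> (d \<in> carrier G \<longrightarrow> {x \<in> carrier G. inv d \<otimes> x \<in> V2} = E \<inter> carrier G)"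
    proof (cases "d \<in> carrier G")
      case True
      then have "openin T {x \<in> carrier G. inv d \<otimes> x \<in> V2}"
        using V2(1) by (intro openin_left_translation) auto
      then show ?thesis
        unfolding T openin_subtopology by auto
    qed (use openin_empty in auto)
  qed
  then obtain E where "\<forall>d. openin B (E d) \<and> (d \<in> carrier G \<longrightarrow> {x \<in> carrier G. inv d \<otimes> x \<in> V2} = E d \<inter> carrier G)"
    unfolding choice_iff by (elim exE)
  then have E_open: "\<And>d. openin B (E d)"
    and E: "\<And>d x. d \<in> carrier G \<Longrightarrow> x \<in> carrier G \<Longrightarrow> x \<in> E d \<longleftrightarrow> inv d \<otimes> x \<in> V2"
    by auto
  have self: "g \<in> E g" if "g \<in> carrier G" for g
    using that V2(2) by (simp add: E)
  \<comment> \<open>If two extended translates meet, they meet at a point of the group, by density.\<close>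
  have meet: "inv g \<otimes> h \<in> V1" if gh: "g \<in> carrier G" "h \<in> carrier G" "E g \<inter> E h \<noteq> {}" for g h
  proof -
    obtain x where x: "x \<in> E g" "x \<in> E h" "x \<in> carrier G"
      using B.dense[of "E g \<inter> E h"] E_open gh(3) by auto
    have "inv g \<otimes> x \<in> V2" "inv x \<otimes> h \<in> V2"
      using x gh E V2(3)[of "inv h \<otimes> x"] by (simp_all add: inv_inv_mult)
    then show ?thesis
      using V2(4) inv_mult_trans[OF gh(1) x(3) gh(2)] by metis
  qed
  have "countable D"
  proof (rule B.locally_finite_disjoint_open_family_countable[of D E])
    show "openin B (E d)" for d by (rule E_open)
    show "E d \<noteq> {}" if "d \<in> D" for d
      using self[OF DG[OF that]] by auto
    show "E d \<inter> E d' = {}" if "d \<in> D" "d' \<in> D" "d \<noteq> d'" for d d'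
      using meet[OF DG[OF that(1)] DG[OF that(2)]] Dsep[OF that] V1(5) by auto
    fix g assume g: "g \<in> carrier G"
    have unique: "d = d'" if d: "d \<in> D" "d' \<in> D" "E g \<inter> E d \<noteq> {}" "E g \<inter> E d' \<noteq> {}" for d d'
    proof (rule ccontr)
      assume "d \<noteq> d'"
      have "inv g \<otimes> d \<in> V1" "inv g \<otimes> d' \<in> V1"
        using meet g DG d by auto
      then have "(inv d \<otimes> g) \<otimes> (inv g \<otimes> d') \<in> V"
        using V1(3)[of "inv g \<otimes> d"] V1(4) inv_inv_mult[OF g DG[OF d(1)]] by metis
      then show False
        using Dsep[OF d(1,2) \<open>d \<noteq> d'\<close>] inv_mult_trans[OF DG[OF d(1)] g DG[OF d(2)]] by simp
    qed
    have "\<exists>d. {d\<in>D. E g \<inter> E d \<noteq> {}} \<subseteq> {d}"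
    proof (cases "{d\<in>D. E g \<inter> E d \<noteq> {}} = {}")
      case False
      then obtain d0 where d0: "d0 \<in> D" "E g \<inter> E d0 \<noteq> {}"
        by auto
      have "{d\<in>D. E g \<inter> E d \<noteq> {}} \<subseteq> {d0}"
      proof
        fix d assume "d \<in> {d\<in>D. E g \<inter> E d \<noteq> {}}"
        then have "d = d0"
          using d0 by (intro unique) simp_all
        then show "d \<in> {d0}" by simp
      qed
      then show ?thesis by (rule exI)
    next
      case True
      then have "{d\<in>D. E g \<inter> E d \<noteq> {}} \<subseteq> {g}"
        by (simp only: empty_subsetI)
      then show ?thesis by (rule exI)
    qed
    then have "finite {d\<in>D. E g \<inter> E d \<noteq> {}}"
      using finite_subset by auto
    then show "\<exists>U. openin B U \<and> g \<in> U \<and> finite {d\<in>D. U \<inter> E d \<noteq> {}}"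
      using E_open self[OF g] by auto
  qed
  then show ?thesis
  proof (rule that)
    show "D \<subseteq> carrier G"
      using DG by auto
    show "\<exists>d\<in>D. inv d \<otimes> g \<in> W" if g: "g \<in> carrier G" for g
      using cover[OF g] V(4) by auto
  qed
qed

text \<open>
  The differences of the members of a \<open>\<pi>\<close>-base contain a neighbourhood base \<open>S V\<close> of the unit, and
  points \<open>v V\<close> chosen from the members form a dense set; the translates of the inverses of the \<open>S V\<close>
  by these points form a network.
\<close>

lemma countable_pi_base_imp_network:
  assumes \<V>: "countable \<V>" "\<And>V. V \<in> \<V> \<Longrightarrow> openin T V \<and> V \<noteq> {}"
    and pi: "\<And>U. openin T U \<Longrightarrow> U \<noteq> {} \<Longrightarrow> \<exists>V\<in>\<V>. V \<subseteq> U"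
  obtains \<N> where "countable \<N>" "network_on T (carrier G) \<N>"
proof -
  have "\<forall>V\<in>\<V>. \<exists>v. v \<in> V"
    using \<V>(2) by auto
  then obtain v where v: "\<And>V. V \<in> \<V> \<Longrightarrow> v V \<in> V"
    by metis
  have vG: "v V \<in> carrier G" if "V \<in> \<V>" for V
    using openin_carrier v \<V>(2) that by metis
  define S where "S V = {z \<in> carrier G. v V \<otimes> z \<in> V}" for V
  have S: "openin T (S V)" "\<one> \<in> S V" if "V \<in> \<V>" for V
    unfolding S_def using open_difference_neighbourhood[OF conjunct1[OF \<V>(2)] v] that by auto
  have S_small: "\<exists>V\<in>\<V>. S V \<subseteq> U" if U: "openin T U" "\<one> \<in> U" for U
  proof -
    obtain M where M: "openin T M" "\<one> \<in> M" "\<And>x. x \<in> M \<Longrightarrow> inv x \<in> M"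
      "\<And>x y. x \<in> M \<Longrightarrow> y \<in> M \<Longrightarrow> x \<otimes> y \<in> U"
      using U by (rule symmetric_square_root) (assumption | rule that)+
    obtain V where V: "V \<in> \<V>" "V \<subseteq> M"
      using pi[OF M(1)] M(2) by auto
    have "S V \<subseteq> U"
    proof
      fix z assume z: "z \<in> S V"
      then have "inv (v V) \<otimes> (v V \<otimes> z) \<in> U"
        using M(3,4) V v[OF V(1)] by (auto simp: S_def)
      then show "z \<in> U"
        using z vG[OF V(1)] by (simp add: S_def inv_mult_cancel)
    qed
    with V(1) show ?thesis by auto
  qed
  define Q where "Q p = {x \<in> carrier G. inv x \<otimes> v (snd p) \<in> S (fst p)}" for p
  have "\<exists>A\<in>Q ` (\<V> \<times> \<V>). g \<in> A \<and> A \<inter> carrier G \<subseteq> U" if U: "openin T U" "g \<in> U" for g U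
  proof -
    have g: "g \<in> carrier G"
      using openin_carrier[OF U] .
    have "openin T {z \<in> carrier G. g \<otimes> z \<in> U}" "\<one> \<in> {z \<in> carrier G. g \<otimes> z \<in> U}"
      by (rule open_difference_neighbourhood[OF U])+
    then obtain M where M: "openin T M" "\<one> \<in> M" "\<And>x. x \<in> M \<Longrightarrow> inv x \<in> M"
      "\<And>x y. x \<in> M \<Longrightarrow> y \<in> M \<Longrightarrow> x \<otimes> y \<in> {z \<in> carrier G. g \<otimes> z \<in> U}"
      by (rule symmetric_square_root) (assumption | rule that)+
    obtain V where V: "V \<in> \<V>" "S V \<subseteq> M"
      using S_small[OF M(1,2)] by auto
    have "openin T {x \<in> carrier G. inv g \<otimes> x \<in> S V}"
      using g S(1)[OF V(1)] by (intro openin_left_translation) auto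
    moreover have "{x \<in> carrier G. inv g \<otimes> x \<in> S V} \<noteq> {}"
      using g S(2)[OF V(1)] by (auto intro!: exI[of _ g])
    ultimately have "\<exists>V'\<in>\<V>. V' \<subseteq> {x \<in> carrier G. inv g \<otimes> x \<in> S V}"
      by (rule pi)
    then obtain V' where V': "V' \<in> \<V>" "V' \<subseteq> {x \<in> carrier G. inv g \<otimes> x \<in> S V}"
      by (elim bexE)
    then have gv: "inv g \<otimes> v V' \<in> S V"
      using v by auto
    have "Q (V, V') \<subseteq> U"
    proof
      fix x assume "x \<in> Q (V, V')"
      then have x: "x \<in> carrier G" "inv x \<otimes> v V' \<in> S V"
        by (auto simp: Q_def)
      then have "inv (v V') \<otimes> x \<in> M"
        using M(3)[of "inv x \<otimes> v V'"] V(2) inv_inv_mult[OF x(1) vG[OF V'(1)]] by auto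
      then have "(inv g \<otimes> v V') \<otimes> (inv (v V') \<otimes> x) \<in> {z \<in> carrier G. g \<otimes> z \<in> U}"
        using gv V(2) by (intro M(4)) auto
      then have "g \<otimes> (inv g \<otimes> x) \<in> U"
        using inv_mult_trans[OF g vG[OF V'(1)] x(1)] by simp
      then show "x \<in> U"
        using g x(1) by (simp add: mult_inv_cancel)
    qed
    moreover have "g \<in> Q (V, V')"
      using g gv by (simp add: Q_def)
    ultimately show ?thesis
      using V(1) V'(1) by (intro bexI[of _ "Q (V, V')"]) auto
  qed
  then have "network_on T (carrier G) (Q ` (\<V> \<times> \<V>))"
    unfolding network_on_def by simp
  moreover have "countable (Q ` (\<V> \<times> \<V>))"
    using \<V>(1) by simp
  ultimately show ?thesis
    by (intro that)
qed

end

section \<open>The compactification of the group\<close>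

lemma quasi_Gdelta_diagonal_imp_separating_families:
  assumes "quasi_Gdelta_diagonal (subtopology X S)" "S \<subseteq> topspace X"
  shows "\<exists>\<G>. separating_families X S \<G>"
proof -
  obtain \<G> :: "nat \<Rightarrow> 'a set set" where "\<forall>n. \<forall>U\<in>\<G> n. openin (subtopology X S) U"
    "\<forall>x\<in>topspace (subtopology X S).
       p_network_at (subtopology X S) x {star x (\<G> n) | n. star x (\<G> n) \<noteq> {}}"
    using assms(1) unfolding quasi_Gdelta_diagonal_def by (elim exE conjE)
  then have \<G>: "\<And>n U. U \<in> \<G> n \<Longrightarrow> openin (subtopology X S) U"
    "\<And>x. x \<in> S \<Longrightarrow> p_network_at (subtopology X S) x {star x (\<G> n) | n. star x (\<G> n) \<noteq> {}}"
    using assms(2) by (simp_all add: Int_absorb1)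
  define \<H> where "\<H> n = {W. openin X W \<and> W \<inter> S \<in> \<G> n}" for n
  have "\<exists>n. x \<in> \<Union>(\<H> n) \<and> (\<forall>W\<in>\<H> n. x \<in> W \<longrightarrow> y \<notin> W)" if xy: "x \<in> S" "y \<in> S" "x \<noteq> y" for x y
  proof -
    have "\<exists>P\<in>{star x (\<G> n) | n. star x (\<G> n) \<noteq> {}}. x \<in> P \<and> P \<subseteq> topspace (subtopology X S) - {y}"
      using \<G>(2)[OF xy(1)] xy assms(2) unfolding p_network_at_def by auto
    then obtain n where n: "x \<in> star x (\<G> n)" "star x (\<G> n) \<subseteq> topspace (subtopology X S) - {y}"
      by auto
    then obtain U where U: "U \<in> \<G> n" "x \<in> U"
      by (auto simp: star_def)
    obtain W where W: "openin X W" "U = W \<inter> S"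
      using \<G>(1)[OF U(1)] unfolding openin_subtopology by auto
    have "W \<in> \<H> n" "x \<in> W"
      using U W by (auto simp: \<H>_def)
    moreover have "y \<notin> W'" if W': "W' \<in> \<H> n" "x \<in> W'" for W'
    proof
      assume "y \<in> W'"
      then have "y \<in> star x (\<G> n)"
        using W' xy unfolding star_def \<H>_def by auto
      then show False using n(2) by auto
    qed
    ultimately show ?thesis
      by (intro exI[of _ n]) auto
  qed
  then have "separating_families X S \<H>"
    unfolding separating_families_def by (simp add: \<H>_def)
  then show ?thesis
    by (intro exI[of _ \<H>])
qed

text \<open>
  With \<open>H\<close> and \<open>W n\<close> as in \<open>compact_countable_character\<close>, the compact translate \<open>gH\<close> has disjoint
  neighbourhoods from any \<open>y\<close> in the remainder, and \<open>g (W n)\<close> lies in the first of them for some \<open>n\<close>.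
  If \<open>d\<close> is \<open>W (Suc n)\<close>-close to \<open>g\<close>, then \<open>d (W (Suc n)) \<subseteq> g (W n)\<close>; so the extensions \<open>E d n\<close> of countably
  many translates separate the group from its remainder.
\<close>

lemma (in topological_group) countable_network_of_compactification:
  assumes T: "T = subtopology bG (carrier G)" and dc: "locally_separated_remainder bG (carrier G)"
  obtains \<N> where "countable \<N>" "network_on bG (topspace bG) \<N>"
proof -
  let ?X = "carrier G"
  interpret locally_separated_remainder bG ?X by fact
  note bG = compact Hausdorff and X_sub = subset and reg = regular
  obtain F and V :: "nat \<Rightarrow> 'a set" where F: "compactin bG F" "F \<subseteq> ?X"
    and V: "\<And>n. openin bG (V n)" "\<And>n. V n \<noteq> {}" "\<And>W. openin bG W \<Longrightarrow> F \<subseteq> W \<Longrightarrow> \<exists>n. V n \<subseteq> W"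
    by (rule countable_pi_base_at_compact) (assumption | rule that)+
  have FT: "compactin T F"
    unfolding T using F by (simp add: compactin_subtopology)
  have openT: "openin T (U \<inter> ?X)" if "openin bG U" for U
    unfolding T using that by (rule openin_subtopology_Int)
  have VT: "openin T (V n \<inter> ?X)" "V n \<inter> ?X \<noteq> {}" for n
    using openT[OF V(1)] dense[OF V(1,2)] .
  have pi: "\<exists>n. V n \<inter> ?X \<subseteq> W" if W: "openin T W" "F \<subseteq> W" for W
  proof -
    obtain O' where O': "openin bG O'" "W = O' \<inter> ?X"
      using W(1) unfolding T openin_subtopology by auto
    then obtain n where "V n \<subseteq> O'"
      using V(3)[of O'] W(2) by auto
    then show ?thesis
      using O'(2) by (intro exI[of _ n]) auto
  qed
  obtain H and W :: "nat \<Rightarrow> 'a set" where H: "compactin T H"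
    and W: "\<And>n. openin T (W n)" "\<And>n. \<one> \<in> W n" "\<And>n x. x \<in> W n \<Longrightarrow> inv x \<in> W n"
      "\<And>n x y. x \<in> W (Suc n) \<Longrightarrow> y \<in> W (Suc n) \<Longrightarrow> x \<otimes> y \<in> W n"
      "\<And>U. openin T U \<Longrightarrow> H \<subseteq> U \<Longrightarrow> \<exists>n. W n \<subseteq> U"
    by (rule compact_countable_character[OF FT VT pi]) (assumption | rule that)+
  have "\<forall>n. \<exists>D. countable D \<and> D \<subseteq> ?X \<and> (\<forall>g\<in>?X. \<exists>d\<in>D. inv d \<otimes> g \<in> W n)"
    using narrow_covering[OF T dc W(1,2)] by metis
  then obtain D where D: "\<And>n. countable (D n)" "\<And>n. D n \<subseteq> ?X"
    "\<And>n g. g \<in> ?X \<Longrightarrow> \<exists>d\<in>D n. inv d \<otimes> g \<in> W n"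
    by metis
  \<comment> \<open>The largest open set of the compactification with the given trace on the group.\<close>
  define E where "E d n = bG interior_of (topspace bG - ?X \<union> {x \<in> ?X. inv d \<otimes> x \<in> W n})" for d n
  have E_mem: "inv d \<otimes> x \<in> W n" if "x \<in> E d n" "x \<in> ?X" for d n x
    using interior_of_subset[of bG "topspace bG - ?X \<union> {x \<in> ?X. inv d \<otimes> x \<in> W n}"] that
    by (auto simp: E_def)
  have E_memI: "x \<in> E d n" if x: "x \<in> ?X" "d \<in> ?X" "inv d \<otimes> x \<in> W n" for x d n
  proof -
    have "openin T {x \<in> ?X. inv d \<otimes> x \<in> W n}"
      using x(2) W(1) by (intro openin_left_translation) auto
    then obtain O' where O': "openin bG O'" "{x \<in> ?X. inv d \<otimes> x \<in> W n} = O' \<inter> ?X"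
      unfolding T openin_subtopology by auto
    have "O' \<subseteq> topspace bG - ?X \<union> {x \<in> ?X. inv d \<otimes> x \<in> W n}"
      unfolding O'(2) using openin_subset[OF O'(1)] by auto
    then have "O' \<subseteq> E d n"
      unfolding E_def by (rule interior_of_maximal[OF _ O'(1)])
    then show ?thesis
      using O'(2) x by auto
  qed
  define \<E> where "\<E> = (\<Union>n. (\<lambda>d. E d n) ` D n)"
  have sep: "\<exists>A\<in>\<E>. g \<in> A \<and> y \<notin> bG closure_of A" if gy: "g \<in> ?X" "y \<in> topspace bG - ?X" for g y
  proof -
    have HG: "H \<subseteq> ?X"
      using compactin_subset_topspace[OF H] topspace_eq by simp
    have "compactin T ((\<lambda>x. g \<otimes> x) ` H)"
      by (rule image_compactin[OF H continuous_map_left_translation[OF gy(1)]])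
    then have "compactin bG ((\<lambda>x. g \<otimes> x) ` H)"
      unfolding T by (simp add: compactin_subtopology)
    then have "closedin bG ((\<lambda>x. g \<otimes> x) ` H)"
      using compactin_imp_closedin[OF bG(2)] by auto
    then have op: "openin bG (topspace bG - (\<lambda>x. g \<otimes> x) ` H)"
      by auto
    have "y \<in> topspace bG - (\<lambda>x. g \<otimes> x) ` H"
      using gy HG by auto
    from regular_shrink[OF reg op this] obtain U where U: "openin bG U" "y \<in> U"
      "bG closure_of U \<subseteq> topspace bG - (\<lambda>x. g \<otimes> x) ` H"
      by metis
    define O' where "O' = topspace bG - bG closure_of U"
    have O': "openin bG O'"
      by (auto simp: O'_def)
    have "openin T {x \<in> ?X. g \<otimes> x \<in> O' \<inter> ?X}"
      by (rule openin_left_translation[OF gy(1) openT[OF O']])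
    moreover have "H \<subseteq> {x \<in> ?X. g \<otimes> x \<in> O' \<inter> ?X}"
    proof
      fix x assume x: "x \<in> H"
      then have "x \<in> ?X" "g \<otimes> x \<in> ?X" "g \<otimes> x \<notin> bG closure_of U"
        using U(3) HG gy(1) by auto
      then show "x \<in> {x \<in> ?X. g \<otimes> x \<in> O' \<inter> ?X}"
        using subsetD[OF X_sub] by (simp add: O'_def)
    qed
    ultimately have "\<exists>n. W n \<subseteq> {x \<in> ?X. g \<otimes> x \<in> O' \<inter> ?X}"
      by (rule W(5))
    then obtain n where n: "W n \<subseteq> {x \<in> ?X. g \<otimes> x \<in> O' \<inter> ?X}"
      by (rule exE)
    obtain d where d: "d \<in> D (Suc n)" "inv d \<otimes> g \<in> W (Suc n)"
      using D(3)[OF gy(1)] by metis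
    have dX: "d \<in> ?X"
      using d(1) D(2) by auto
    have "E d (Suc n) \<inter> U = {}"
    proof (rule ccontr)
      assume "E d (Suc n) \<inter> U \<noteq> {}"
      moreover have "openin bG (E d (Suc n) \<inter> U)"
        using U(1) by (auto simp: E_def)
      ultimately obtain x where x: "x \<in> E d (Suc n)" "x \<in> U" "x \<in> ?X"
        using dense[of "E d (Suc n) \<inter> U"] by auto
      have "inv g \<otimes> d \<in> W (Suc n)"
        using W(3)[OF d(2)] inv_inv_mult[OF dX gy(1)] by simp
      then have "(inv g \<otimes> d) \<otimes> (inv d \<otimes> x) \<in> W n"
        using W(4) E_mem[OF x(1,3)] by metis
      then have "g \<otimes> (inv g \<otimes> x) \<in> O'"
        using n inv_mult_trans[OF gy(1) dX x(3)] by auto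
      then have "x \<in> O'"
        using mult_inv_cancel[OF gy(1) x(3)] by simp
      then show False
        using x(2) closure_of_subset[OF openin_subset[OF U(1)]] by (auto simp: O'_def)
    qed
    then have "y \<notin> bG closure_of (E d (Suc n))"
      using U(1,2) unfolding in_closure_of by auto
    moreover have "g \<in> E d (Suc n)"
      by (rule E_memI[OF gy(1) dX d(2)])
    moreover have "E d (Suc n) \<in> \<E>"
      using d(1) by (auto simp: \<E>_def)
    ultimately show ?thesis
      by (intro bexI[of _ "E d (Suc n)"]) simp_all
  qed
  have \<E>_countable: "countable \<E>"
    unfolding \<E>_def using D(1) by (intro countable_UN) auto
  have \<E>_open: "openin bG A" if "A \<in> \<E>" for A
    using that by (auto simp: \<E>_def E_def)
  obtain \<N> \<V> where \<N>: "countable \<N>" "network_on bG (topspace bG - ?X) \<N>"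
    and \<V>: "countable \<V>" "\<And>V. V \<in> \<V> \<Longrightarrow> openin bG V \<and> V \<noteq> {}"
      "\<And>W. openin bG W \<Longrightarrow> W \<noteq> {} \<Longrightarrow> \<exists>V\<in>\<V>. V \<subseteq> W"
    by (rule network_and_pi_base_of_separating_open_family[OF \<E>_countable \<E>_open sep]) (assumption | rule that)+
  have cV: "countable ((\<lambda>V. V \<inter> ?X) ` \<V>)"
    using \<V>(1) by simp
  have oV: "openin T V \<and> V \<noteq> {}" if "V \<in> (\<lambda>V. V \<inter> ?X) ` \<V>" for V
  proof -
    obtain A where A: "A \<in> \<V>" "V = A \<inter> ?X"
      using \<open>V \<in> _\<close> by auto
    then show ?thesis
      using \<V>(2)[OF A(1)] openT dense by auto
  qed
  have pV: "\<exists>V\<in>(\<lambda>V. V \<inter> ?X) ` \<V>. V \<subseteq> U" if U: "openin T U" "U \<noteq> {}" for U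
  proof -
    obtain O' where O': "openin bG O'" "U = O' \<inter> ?X"
      using U(1) unfolding T openin_subtopology by auto
    then obtain A where "A \<in> \<V>" "A \<subseteq> O'"
      using \<V>(3)[of O'] U(2) by auto
    then show ?thesis
      using O'(2) by (intro bexI[of _ "A \<inter> ?X"]) auto
  qed
  obtain \<M> where \<M>: "countable \<M>" "network_on T ?X \<M>"
    by (rule countable_pi_base_imp_network[OF cV oV pV]) (assumption | rule that)+
  have \<M>': "network_on bG ?X \<M>"
    unfolding network_on_def
  proof (intro ballI allI impI)
    fix x U assume x: "x \<in> ?X" and U: "openin bG U \<and> x \<in> U"
    then obtain A where "A \<in> \<M>" "x \<in> A" "A \<inter> ?X \<subseteq> U \<inter> ?X"
      using network_onD[OF \<M>(2) x openT[of U]] by auto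
    then show "\<exists>A\<in>\<M>. x \<in> A \<and> A \<inter> ?X \<subseteq> U"
      by (intro bexI[of _ A]) auto
  qed
  have "topspace bG - ?X \<union> ?X = topspace bG"
    using X_sub by auto
  then have "network_on bG (topspace bG) ((\<lambda>A. A \<inter> (topspace bG - ?X)) ` \<N> \<union> (\<lambda>A. A \<inter> ?X) ` \<M>)"
    using network_on_Un[OF \<N>(2) \<M>'] by simp
  then show ?thesis
    using \<N>(1) \<M>(1) by (intro that) simp_all
qed

theorem theorem3p4:
  fixes G :: "('a, 'm) monoid_scheme" and T bG :: "'a topology"
  assumes "topological_group G T"
    and "\<not> locally_compact_space T"
    and "Hausdorff_compactification T bG"
    and "has_locally quasi_Gdelta_diagonal (remainder T bG)"
  shows "separable_space T \<and> metrizable_space T \<and> separable_space bG \<and> metrizable_space bG"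
proof -
  interpret topological_group G T by fact
  let ?X = "carrier G"
  have bG: "compact_space bG" "Hausdorff_space bG" and X_sub: "?X \<subseteq> topspace bG"
    and T: "T = subtopology bG ?X" and X_dense: "bG closure_of ?X = topspace bG"
    using assms(3) unfolding Hausdorff_compactification_def topspace_eq by auto
  have reg: "regular_space bG"
    using compact_Hausdorff_imp_regular_space[OF bG] .
  have dc: "locally_separated_remainder bG ?X"
  proof
    show "compact_space bG" "Hausdorff_space bG" "?X \<subseteq> topspace bG" by fact+
    show "U \<inter> ?X \<noteq> {}" if "openin bG U" "U \<noteq> {}" for U
      using X_dense that unfolding dense_intersects_open by (simp add: Int_commute)
    show "topspace bG \<noteq> {}"
      using X_sub one_closed by auto
    \<comment> \<open>An open set inside the group would make the group locally compact.\<close>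
    show "U - ?X \<noteq> {}" if U: "openin bG U" "U \<noteq> {}" for U
    proof
      assume UX: "U - ?X = {}"
      obtain u where u: "u \<in> U" using U(2) by auto
      obtain V where V: "openin bG V" "u \<in> V" "bG closure_of V \<subseteq> U"
        using regular_shrink[OF reg U(1) u] by metis
      have sub: "bG closure_of V \<subseteq> ?X"
        using V(3) UX by auto
      have "compactin bG (bG closure_of V)"
        using closedin_compact_space[OF bG(1) closedin_closure_of] .
      then have K: "compactin T (bG closure_of V)"
        unfolding T using sub by (simp add: compactin_subtopology)
      have Vsub: "V \<subseteq> bG closure_of V"
        using closure_of_subset[OF openin_subset[OF V(1)]] .
      have "openin T V"
        unfolding T openin_subtopology using V(1) Vsub sub by (intro exI[of _ V]) auto
      then show False
        using locally_compact_of_open_in_compact[OF _ _ K Vsub] V(2) assms(2) by auto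
    qed
    fix y assume y: "y \<in> topspace bG - ?X"
    have R: "remainder T bG = subtopology bG (topspace bG - ?X)"
      by (simp add: remainder_def topspace_eq)
    obtain U where U: "openin (remainder T bG) U" "y \<in> U"
      "quasi_Gdelta_diagonal (subtopology (remainder T bG) U)"
      using assms(4) y unfolding has_locally_def R by auto
    obtain W where W: "openin bG W" "U = W \<inter> (topspace bG - ?X)"
      using U(1) unfolding R openin_subtopology by auto
    have eq: "U = W - ?X"
      using W openin_subset[OF W(1)] by auto
    have "subtopology (remainder T bG) U = subtopology bG (W - ?X)"
      unfolding R subtopology_subtopology eq[symmetric] using W(2) by (simp add: Int_absorb1)
    then have "\<exists>\<G>. separating_families bG (W - ?X) \<G>"
      using quasi_Gdelta_diagonal_imp_separating_families[of bG "W - ?X"] U(3) openin_subset[OF W(1)] by auto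
    then show "\<exists>U. openin bG U \<and> y \<in> U \<and> (\<exists>\<G>. separating_families bG (U - ?X) \<G>)"
      using W(1) U(2) eq by auto
  qed
  obtain \<N> where \<N>: "countable \<N>" "network_on bG (topspace bG) \<N>"
    by (rule countable_network_of_compactification[OF T dc])
  have "metrizable_space bG"
    by (rule compact_Hausdorff_network_metrizable[OF bG \<N>])
  moreover have "separable_space bG"
    using network_on_separable[OF \<N>] by simp
  moreover have "separable_space T"
    unfolding T by (rule network_on_separable[OF \<N>(1) network_on_subset[OF \<N>(2) X_sub] X_sub])
  ultimately show ?thesis
    using metrizable_space_subtopology[of bG ?X] T by metis
qed

end
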